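(* Let $(Z_n)_{n\ge 0}$ be a branching process in random environment with linear fractional offspring distributions, started from $Z_0=1$. Assume that $$0<\mathbb{E}\big[Xe^{-X}\big]<\infty$$ and that $\mathbf{E}\big[\log(1-Q(0))\big]>-\infty$. Then for every $c\in\mathbb{N}$ and $1\le k\le c$, $$\lim_{n\to\infty}\mathbb{P}(Z_n=k\mid 1\le Z_n\le c)=\frac1c ,$$ i.e. the limiting distribution is uniform on $\{1,\dots,c\}$.
   Context: Let $\Delta$ be the space of probability distributions on $\mathbb{N}_0=\{0,1,2,\dots\}$, and $\mathbb{N}=\{1,2,\dots\}$; for $q\in\Delta$ write $q(y):=q(\{y\})$ and $m(q):=\sum_{y\ge 0} y\,q(y)$. Let $Q$ be a $\Delta$-valued random variable. Throughout, $Q$ is a.s. linear fractional: $Q(0)=a$ and $Q(k)=\frac{(1-a)(1-p)}{p}p^k$ for $k\ge 1$, where $a\in[0,1)$ and $p\in(0,1)$ are random parameters. A random environment is an i.i.d. sequence $\Pi=(Q_1,Q_2,\dots)$ of copies of $Q$. The branching process $(Z_n)_{n\ge0}$ in the environment $\Pi$: $Z_0$ is independent of $\Pi$ and, given $\Pi$, $(Z_n)$ is a Markov chain with $\mathcal{L}(Z_n\mid Z_{n-1}=z,\Pi=(q_1,q_2,\dots))=q_n^{*z}$ ($z$-fold convolution). $\mathbb{P}$ denotes the law with $Z_0=1$. Let $X:=\log m(Q)$. The process is supercritical, i.e. $\mathbb{E}[X]>0$. Change of measure: with $\gamma:=\mathbb{E}[e^{-X}]$ (finite under the hypotheses), $\mathbf{P}$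 (with expectation $\mathbf{E}$) is the measure determined by $\mathbf{E}[\phi(Q)]:=\gamma^{-1}\mathbb{E}[e^{-X}\phi(Q)]$ for bounded measurable $\phi:\Delta\to\mathbb{R}$; under $\mathbf{P}$ the environment $Q_1,Q_2,\dots$ is i.i.d. with this tilted law, and the conditional law of $(Z_n)$ given $\Pi$ is unchanged. *)

theory Defs
  imports "HOL-Probability.Probability"
begin

(* The space Delta of probability distributions on the natural numbers. Its sigma-algebra is the
   one of the Giry monad, i.e. it is generated by the evaluations q \<mapsto> q(A). *)
definition offspring_laws :: "nat pmf measure" where
  "offspring_laws = vimage_algebra UNIV measure_pmf (prob_algebra (count_space UNIV))"

(* suminf is a real number here, hence only meaningful for laws with finite mean; all
   linear fractional laws have finite positive mean. *)
definition offspring_mean :: "nat pmf \<Rightarrow> real" where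
  "offspring_mean q = (\<Sum>y. real y * pmf q y)"

definition log_mean :: "nat pmf \<Rightarrow> real" where
  "log_mean q = ln (offspring_mean q)"

definition linear_fractional :: "nat pmf \<Rightarrow> bool" where
  "linear_fractional q \<longleftrightarrow>
     (\<exists>a p. 0 \<le> a \<and> a < 1 \<and> 0 < p \<and> p < 1 \<and> pmf q 0 = a \<and>
        (\<forall>k\<ge>1. pmf q k = (1 - a) * (1 - p) / p * p ^ k))"

primrec convolution_power :: "nat pmf \<Rightarrow> nat \<Rightarrow> nat pmf" where
  "convolution_power q 0 = return_pmf 0"
| "convolution_power q (Suc z) =
     map_pmf (\<lambda>(x, y). x + y) (pair_pmf q (convolution_power q z))"

(* The environment is Env 1, Env 2, ...; the value Env 0 plays no role. *)
locale random_environment = prob_space M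
  for M :: "'w measure" +
  fixes Q :: "'w \<Rightarrow> nat pmf" and Env :: "nat \<Rightarrow> 'w \<Rightarrow> nat pmf"
  assumes random_law: "random_variable offspring_laws Q"
    and env_indep: "indep_vars (\<lambda>_. offspring_laws) Env {1..}"
    and env_copies: "\<And>n. 1 \<le> n \<Longrightarrow> distr M offspring_laws (Env n) = distr M offspring_laws Q"

definition env_algebra :: "'w measure \<Rightarrow> (nat \<Rightarrow> 'w \<Rightarrow> nat pmf) \<Rightarrow> 'w measure" where
  "env_algebra M Env =
     vimage_algebra (space M) (\<lambda>\<omega>. \<lambda>i\<in>{1..}. Env i \<omega>) (PiM {1..} (\<lambda>_. offspring_laws))"

(* The sigma-algebra generated by the whole environment and Z 0, ..., Z n. *)
definition history ::
  "'w measure \<Rightarrow> (nat \<Rightarrow> 'w \<Rightarrow> nat pmf) \<Rightarrow> (nat \<Rightarrow> 'w \<Rightarrow> nat) \<Rightarrow> nat \<Rightarrow> 'w measure" where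
  "history M Env Z n =
     vimage_algebra (space M)
       (\<lambda>\<omega>. (\<lambda>i\<in>{1..}. Env i \<omega>, \<lambda>i\<in>{..n}. Z i \<omega>))
       (PiM {1..} (\<lambda>_. offspring_laws) \<Otimes>\<^sub>M PiM {..n} (\<lambda>_. count_space UNIV))"

(* "branching" says that, given the environment, Z is a Markov chain whose n-th transition
   kernel is z \<mapsto> z-fold convolution of Env n: the conditional law of Z n given the environment
   and the entire past up to n - 1 is the (Z (n - 1))-fold convolution of Env n. *)
locale branching_process_re = random_environment M Q Env
  for M :: "'w measure" and Q Env +
  fixes Z :: "nat \<Rightarrow> 'w \<Rightarrow> nat"
  assumes random_size: "\<And>n. random_variable (count_space UNIV) (Z n)"
    and initial_indep:
      "indep_set (sets (env_algebra M Env)) (sets (vimage_algebra (space M) (Z 0) (count_space UNIV)))"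
    and branching:
      "\<And>n j. 1 \<le> n \<Longrightarrow>
         AE \<omega> in M. real_cond_exp M (history M Env Z (n - 1)) (indicator {\<omega>\<in>space M. Z n \<omega> = j}) \<omega>
           = pmf (convolution_power (Env n \<omega>) (Z (n - 1) \<omega>)) j"

(* The expectation of Y exists in the extended sense and is positive (possibly infinite);
   ennreal truncates negative numbers to 0, so the two sides are E[Y^-] and E[Y^+]. *)
definition pos_expectation :: "'w measure \<Rightarrow> ('w \<Rightarrow> real) \<Rightarrow> bool" where
  "pos_expectation M Y \<longleftrightarrow> (\<integral>\<^sup>+\<omega>. ennreal (- Y \<omega>) \<partial>M) < (\<integral>\<^sup>+\<omega>. ennreal (Y \<omega>) \<partial>M)"

definition tilt_const :: "'w measure \<Rightarrow> ('w \<Rightarrow> nat pmf) \<Rightarrow> real" where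
  "tilt_const M Q = (\<integral>\<omega>. exp (- log_mean (Q \<omega>)) \<partial>M)"

(* The law of Q under the changed measure; cf. integral_tilted_law. *)
definition tilted_law :: "'w measure \<Rightarrow> ('w \<Rightarrow> nat pmf) \<Rightarrow> nat pmf measure" where
  "tilted_law M Q =
     density (distr M offspring_laws Q) (\<lambda>q. ennreal (exp (- log_mean q) / tilt_const M Q))"

lemma measurable_measure_pmf [measurable]:
  "measure_pmf \<in> offspring_laws \<rightarrow>\<^sub>M prob_algebra (count_space UNIV)"
  unfolding offspring_laws_def
  by (rule measurable_vimage_algebra1)
     (auto simp: space_prob_algebra measure_pmf.prob_space_axioms)

lemma measurable_pmf_eval [measurable]: "(\<lambda>q. pmf q y) \<in> borel_measurable offspring_laws"
proof -
  have "measure_pmf \<in> offspring_laws \<rightarrow>\<^sub>M subprob_algebra (count_space UNIV)"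
    using measurable_measure_pmf by (rule measurable_prob_algebraD)
  then have "(\<lambda>q. emeasure (measure_pmf q) {y}) \<in> borel_measurable offspring_laws"
    by (rule measurable_emeasure_kernel) simp
  then show ?thesis
    by (simp add: emeasure_pmf_single)
qed

lemma measurable_log_mean [measurable]: "log_mean \<in> borel_measurable offspring_laws"
  unfolding log_mean_def [abs_def] offspring_mean_def [abs_def] by measurable

lemma integral_tilted_law:
  fixes \<phi> :: "nat pmf \<Rightarrow> real"
  assumes [measurable]: "Q \<in> M \<rightarrow>\<^sub>M offspring_laws" "\<phi> \<in> borel_measurable offspring_laws"
  shows "(\<integral>q. \<phi> q \<partial>tilted_law M Q)
           = inverse (tilt_const M Q) * (\<integral>\<omega>. exp (- log_mean (Q \<omega>)) * \<phi> (Q \<omega>) \<partial>M)"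
proof -
  have "0 \<le> tilt_const M Q"
    unfolding tilt_const_def by simp
  then have "(\<integral>q. \<phi> q \<partial>tilted_law M Q)
      = (\<integral>\<omega>. exp (- log_mean (Q \<omega>)) / tilt_const M Q * \<phi> (Q \<omega>) \<partial>M)"
    unfolding tilted_law_def by (subst integral_density) (auto simp: integral_distr)
  then show ?thesis
    by (simp add: field_simps)
qed

end

theory Submission
  imports Defs
begin

text \<open>
The generating function of a linear fractional law \<open>q\<close> becomes affine after the substitution
\<open>s \<mapsto> 1 / (1 - s)\<close>: with \<open>x = log m(q)\<close> and \<open>e = p / (1 - a)\<close>,
  \<open>1 / (1 - f(s)) = exp (- x) / (1 - s) + e\<close>.
Composing the first \<open>n\<close> environments therefore gives again a linear fractional law, governed by
\<open>A = exp (- (x\<^sub>1 + \<dots> + x\<^sub>n))\<close> and the perpetuity \<open>B = \<Sum>i\<le>n. e\<^sub>i exp (- (x\<^sub>1 + \<dots> + x\<^bsub>i-1\<^esub>))\<close>.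
Expanding it as a power series yields, for \<open>k \<ge> 1\<close>,
  \<open>P (Z\<^sub>n = k | environment) = A B\<^bsup>k-1\<^esup> / (A + B)\<^bsup>k+1\<^esup>\<close>
(lemma \<open>prob_size_eq\<close>, after averaging over the environment). The factor \<open>A\<close> is, up to \<open>\<gamma>\<^bsup>n\<^esup>\<close>, exactly the density of the tilted environment,
so \<open>P (Z\<^sub>n = k) = \<gamma>\<^bsup>n\<^esup> h\<^sub>k(n)\<close>, where \<open>h\<^sub>k(n)\<close> is the tilted expectation of
\<open>B\<^bsup>k-1\<^esup> / (A + B)\<^bsup>k+1\<^esup>\<close> (lemma \<open>prob_size_eq_tilted\<close>). The claim follows once all \<open>h\<^sub>k\<close> have one and the same
positive limit (lemma \<open>tilted_weight_limit\<close>): the common factor \<open>\<gamma>\<^bsup>n\<^esup>\<close> cancels in the conditional probability,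
and \<open>c\<close> asymptotically equal weights remain.

Under the tilted law \<open>x\<close> has positive mean, so one expects \<open>A \<rightarrow> 0\<close> and \<open>B \<rightarrow> B\<^sub>\<infinity> < \<infinity>\<close>. Two weaker facts,
which follow from monotonicity and need no law of large numbers, are enough.

\<^item> \<open>E [A / (A + B)\<^sup>2] \<rightarrow> 0\<close>, which makes the \<open>h\<^sub>k\<close> asymptotically equal. The expectation of \<open>1 / (1 + B)\<close> decreases
  in \<open>n\<close>, hence its increments vanish; the increment is caused by adding \<open>e\<^bsub>n+1\<^esub> A\<close> to \<open>B\<close>, and \<open>e\<^bsub>n+1\<^esub> > 0\<close> is
  independent of \<open>(A, B)\<close>, so it dominates a multiple of \<open>E [A / (A + B)\<^sup>2]\<close> (lemma \<open>ratio_tendsto_0\<close>).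

\<^item> \<open>h\<^sub>1(n) = E [1 / (A + B)\<^sup>2]\<close> decreases to a positive limit. The sum \<open>D\<^sub>n = A + B\<close> is nondecreasing in \<open>n\<close>, so a limit \<open>0\<close> would
  force \<open>D\<^sub>n \<rightarrow> \<infinity>\<close> almost surely. Peeling off the first environment gives \<open>D\<^bsub>n+1\<^esub> = D\<^sub>n' (exp (- x) + e / D\<^sub>n')\<close> with a copy
  \<open>D\<^sub>n'\<close> of \<open>D\<^sub>n\<close> independent of \<open>(x, e)\<close>; thus \<open>0 \<le> E [ln D\<^bsub>n+1\<^esub>] - E [ln D\<^sub>n] = E [ln (exp (- x) + e / D\<^sub>n)]\<close>, which would
  tend to \<open>- E [x] < 0\<close> (lemma \<open>inverse_square_limit_pos\<close>). Integrability of \<open>ln (1 - Q(0)) = - ln (exp (- x) + e)\<close>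
  provides the majorant.
\<close>

section \<open>Compositions of affine maps in an i.i.d. environment\<close>

text \<open>
For a sequence \<open>\<omega>\<close> of environments, the pair of discount and perpetuity is the product of the first \<open>n\<close>
affine maps \<open>u \<mapsto> e + exp (- x) u\<close>, whose composition is \<open>u \<mapsto> perpetuity + discount * u\<close>.
\<close>

definition discount :: "('a \<Rightarrow> real) \<Rightarrow> (nat \<Rightarrow> 'a) \<Rightarrow> nat \<Rightarrow> real" where
  "discount x \<omega> n = exp (- (\<Sum>i<n. x (\<omega> i)))"

definition perpetuity :: "('a \<Rightarrow> real) \<Rightarrow> ('a \<Rightarrow> real) \<Rightarrow> (nat \<Rightarrow> 'a) \<Rightarrow> nat \<Rightarrow> real" where
  "perpetuity x e \<omega> n = (\<Sum>i<n. e (\<omega> i) * discount x \<omega> i)"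

lemma discount_pos [simp]: "0 < discount x \<omega> n"
  by (simp add: discount_def)

lemma discount_nonneg [simp]: "0 \<le> discount x \<omega> n"
  by (simp add: discount_def)

lemma discount_0 [simp]: "discount x \<omega> 0 = 1"
  by (simp add: discount_def)

lemma perpetuity_0 [simp]: "perpetuity x e \<omega> 0 = 0"
  by (simp add: perpetuity_def)

lemma discount_Suc: "discount x \<omega> (Suc n) = discount x \<omega> n * exp (- x (\<omega> n))"
  by (simp add: discount_def exp_diff exp_minus field_simps)

lemma perpetuity_Suc: "perpetuity x e \<omega> (Suc n) = perpetuity x e \<omega> n + e (\<omega> n) * discount x \<omega> n"
  by (simp add: perpetuity_def)

text \<open>
Appending a last map and prepending a first one give two recursions. The former shows monotonicity in
\<open>n\<close>; the latter, in this and the next lemma, matches the decomposition of an i.i.d. sequence into its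
head and its tail, and is the one to use for integrals over such sequences.
\<close>

lemma discount_case_nat:
  "discount x (case_nat q \<omega>) (Suc n) = exp (- x q) * discount x \<omega> n"
  by (simp add: discount_def sum.lessThan_Suc_shift exp_diff exp_minus field_simps del: sum.lessThan_Suc)

lemma perpetuity_case_nat:
  "perpetuity x e (case_nat q \<omega>) (Suc n) = e q + exp (- x q) * perpetuity x e \<omega> n"
  by (simp add: perpetuity_def sum.lessThan_Suc_shift discount_case_nat sum_distrib_left mult_ac
      del: sum.lessThan_Suc)

text \<open>
The condition \<open>1 \<le> exp (- x) + e\<close> says that each affine map sends \<open>1\<close> to at least \<open>1\<close>; for linear
fractional laws the value is the reciprocal of \<open>1 - q(0)\<close>.
\<close>

lemma perpetuity_bounds:
  fixes x e :: "'a \<Rightarrow> real"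
  assumes "\<forall>i. 0 < e (\<omega> i) \<and> 1 \<le> exp (- x (\<omega> i)) + e (\<omega> i)"
  shows "0 \<le> perpetuity x e \<omega> n" "perpetuity x e \<omega> n \<le> perpetuity x e \<omega> (Suc n)"
    "discount x \<omega> n + perpetuity x e \<omega> n \<le> discount x \<omega> (Suc n) + perpetuity x e \<omega> (Suc n)"
    "1 \<le> discount x \<omega> n + perpetuity x e \<omega> n"
proof -
  show 0: "0 \<le> perpetuity x e \<omega> n" for n
    unfolding perpetuity_def
    using assms by (intro sum_nonneg mult_nonneg_nonneg) (auto simp: less_imp_le)
  show "perpetuity x e \<omega> n \<le> perpetuity x e \<omega> (Suc n)"
    using assms by (auto simp: perpetuity_Suc intro!: mult_nonneg_nonneg less_imp_le)
  show *: "discount x \<omega> n + perpetuity x e \<omega> n \<le> discount x \<omega> (Suc n) + perpetuity x e \<omega> (Suc n)" for n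
    using mult_left_mono[of 1 "exp (- x (\<omega> n)) + e (\<omega> n)" "discount x \<omega> n"] assms
    by (simp add: discount_Suc perpetuity_Suc algebra_simps)
  show "1 \<le> discount x \<omega> n + perpetuity x e \<omega> n"
    by (induction n) (auto intro: order_trans[OF _ *])
qed

lemma measurable_discount [measurable]:
  assumes [measurable]: "x \<in> borel_measurable T"
  shows "(\<lambda>\<omega>. discount x \<omega> n) \<in> borel_measurable (\<Pi>\<^sub>M i\<in>UNIV. T)"
  unfolding discount_def by measurable

lemma measurable_perpetuity [measurable]:
  assumes [measurable]: "x \<in> borel_measurable T" "e \<in> borel_measurable T"
  shows "(\<lambda>\<omega>. perpetuity x e \<omega> n) \<in> borel_measurable (\<Pi>\<^sub>M i\<in>UNIV. T)"
  unfolding perpetuity_def by measurable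

lemma sequence_space_of_prob_space: "prob_space T \<Longrightarrow> sequence_space T"
  unfolding sequence_space_def product_prob_space_def product_sigma_finite_def
    product_prob_space_axioms_def
  by (auto intro: prob_space_imp_sigma_finite)

lemma (in sequence_space) nn_integral_split_first:
  assumes [measurable]: "f \<in> borel_measurable S"
  shows "(\<integral>\<^sup>+\<omega>. f \<omega> \<partial>S) = (\<integral>\<^sup>+q. \<integral>\<^sup>+\<omega>. f (case_nat q \<omega>) \<partial>S \<partial>M)"
proof -
  have "(\<integral>\<^sup>+\<omega>. f \<omega> \<partial>S) = (\<integral>\<^sup>+\<omega>. f \<omega> \<partial>distr (M \<Otimes>\<^sub>M S) S (\<lambda>(s, \<omega>). case_nat s \<omega>))"
    by (simp add: PiM_iter)
  also have "\<dots> = (\<integral>\<^sup>+y. f (case_nat (fst y) (snd y)) \<partial>(M \<Otimes>\<^sub>M S))"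
    by (subst nn_integral_distr) (auto simp: case_prod_beta')
  also have "\<dots> = (\<integral>\<^sup>+q. \<integral>\<^sup>+\<omega>. f (case_nat q \<omega>) \<partial>S \<partial>M)"
    by (subst P.nn_integral_fst[symmetric]) auto
  finally show ?thesis .
qed

text \<open>
Discount and perpetuity at time \<open>n\<close> depend on the coordinates below \<open>n\<close> only, so coordinate \<open>n\<close> may be
integrated separately. Prepending reduces the case \<open>n + 1\<close> to the case \<open>n\<close> with the first map absorbed
into the integrand.
\<close>

lemma (in sequence_space) nn_integral_new_coordinate:
  assumes [measurable]: "x \<in> borel_measurable M" "e \<in> borel_measurable M"
    and "G \<in> borel_measurable (borel \<Otimes>\<^sub>M borel \<Otimes>\<^sub>M M)"
  shows "(\<integral>\<^sup>+\<omega>. G (discount x \<omega> n, perpetuity x e \<omega> n, \<omega> n) \<partial>S)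
    = (\<integral>\<^sup>+\<omega>. \<integral>\<^sup>+q. G (discount x \<omega> n, perpetuity x e \<omega> n, q) \<partial>M \<partial>S)"
  using assms(3)
proof (induction n arbitrary: G)
  case (0 G)
  note [measurable] = 0
  show ?case
    by (subst nn_integral_split_first) (auto simp: P.emeasure_space_1)
next
  case (Suc n G)
  note [measurable] = Suc.prems
  have "(\<integral>\<^sup>+\<omega>. G (discount x \<omega> (Suc n), perpetuity x e \<omega> (Suc n), \<omega> (Suc n)) \<partial>S)
    = (\<integral>\<^sup>+p. \<integral>\<^sup>+\<omega>. G (exp (- x p) * discount x \<omega> n, e p + exp (- x p) * perpetuity x e \<omega> n, \<omega> n) \<partial>S \<partial>M)"
    by (subst nn_integral_split_first) (auto simp: discount_case_nat perpetuity_case_nat)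
  also have "\<dots> = (\<integral>\<^sup>+p. \<integral>\<^sup>+\<omega>. \<integral>\<^sup>+q. G (exp (- x p) * discount x \<omega> n, e p + exp (- x p) * perpetuity x e \<omega> n, q) \<partial>M \<partial>S \<partial>M)"
  proof (rule nn_integral_cong)
    fix p assume [measurable]: "p \<in> space M"
    show "(\<integral>\<^sup>+\<omega>. G (exp (- x p) * discount x \<omega> n, e p + exp (- x p) * perpetuity x e \<omega> n, \<omega> n) \<partial>S)
      = (\<integral>\<^sup>+\<omega>. \<integral>\<^sup>+q. G (exp (- x p) * discount x \<omega> n, e p + exp (- x p) * perpetuity x e \<omega> n, q) \<partial>M \<partial>S)"
      using Suc.IH[of "\<lambda>(a, b, q). G (exp (- x p) * a, e p + exp (- x p) * b, q)"] by simp
  qed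
  also have "\<dots> = (\<integral>\<^sup>+\<omega>. \<integral>\<^sup>+q. G (discount x \<omega> (Suc n), perpetuity x e \<omega> (Suc n), q) \<partial>M \<partial>S)"
    by (subst nn_integral_split_first) (auto simp: discount_case_nat perpetuity_case_nat)
  finally show ?case .
qed

text \<open>
The discount is a product of one weight per coordinate. Normalising each weight turns it into the density
that changes the environment law from \<open>D\<close> to \<open>T\<close>. Working with functions of discount and perpetuity
only, this needs no density for product measures: it follows by induction, one coordinate at a time.
\<close>

lemma nn_integral_tilted_environment:
  fixes D :: "'a measure" and x e :: "'a \<Rightarrow> real"
  assumes D: "prob_space D" and T: "prob_space T"
    and [measurable]: "x \<in> borel_measurable D" "e \<in> borel_measurable D"
    and \<gamma>: "0 < \<gamma>" and T_eq: "T = density D (\<lambda>q. ennreal (exp (- x q) / \<gamma>))"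
    and "G \<in> borel_measurable (borel \<Otimes>\<^sub>M borel)"
  shows "(\<integral>\<^sup>+\<omega>. ennreal (discount x \<omega> n) * G (discount x \<omega> n, perpetuity x e \<omega> n) \<partial>(\<Pi>\<^sub>M i\<in>UNIV. D))
    = ennreal (\<gamma> ^ n) * (\<integral>\<^sup>+\<omega>. G (discount x \<omega> n, perpetuity x e \<omega> n) \<partial>(\<Pi>\<^sub>M i\<in>UNIV. T))"
proof -
  interpret D: sequence_space D by (rule sequence_space_of_prob_space[OF D])
  interpret T: sequence_space T by (rule sequence_space_of_prob_space[OF T])
  have T_sets [measurable_cong]: "sets T = sets D" by (simp add: T_eq)
  show ?thesis using assms(7)
  proof (induction n arbitrary: G)
    case (0 G)
    show ?case
      by (simp add: D.P.emeasure_space_1 T.P.emeasure_space_1)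
  next
    case (Suc n G)
    note [measurable] = Suc.prems
    let ?d = "\<lambda>\<omega>. discount x \<omega> n" and ?p = "\<lambda>\<omega>. perpetuity x e \<omega> n"
    let ?G = "\<lambda>q \<omega>. G (exp (- x q) * ?d \<omega>, e q + exp (- x q) * ?p \<omega>)"
    have [measurable]: "x \<in> borel_measurable T" "e \<in> borel_measurable T"
      by measurable
    have "(\<integral>\<^sup>+\<omega>. ennreal (discount x \<omega> (Suc n)) * G (discount x \<omega> (Suc n), perpetuity x e \<omega> (Suc n)) \<partial>D.S)
      = (\<integral>\<^sup>+q. \<integral>\<^sup>+\<omega>. ennreal (exp (- x q)) * (ennreal (?d \<omega>) * ?G q \<omega>) \<partial>D.S \<partial>D)"
      by (subst D.nn_integral_split_first)
         (auto simp: discount_case_nat perpetuity_case_nat ennreal_mult mult_ac)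
    also have "\<dots> = (\<integral>\<^sup>+q. ennreal (exp (- x q)) * (ennreal (\<gamma> ^ n) * (\<integral>\<^sup>+\<omega>. ?G q \<omega> \<partial>T.S)) \<partial>D)"
    proof (rule nn_integral_cong)
      fix q assume [measurable]: "q \<in> space D"
      show "(\<integral>\<^sup>+\<omega>. ennreal (exp (- x q)) * (ennreal (?d \<omega>) * ?G q \<omega>) \<partial>D.S)
        = ennreal (exp (- x q)) * (ennreal (\<gamma> ^ n) * (\<integral>\<^sup>+\<omega>. ?G q \<omega> \<partial>T.S))"
        using Suc.IH[of "\<lambda>(a, b). G (exp (- x q) * a, e q + exp (- x q) * b)"]
        by (simp add: nn_integral_cmult)
    qed
    also have "\<dots> = (\<integral>\<^sup>+q. ennreal (\<gamma> ^ Suc n) * (ennreal (exp (- x q) / \<gamma>) * (\<integral>\<^sup>+\<omega>. ?G q \<omega> \<partial>T.S)) \<partial>D)"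
    proof (rule nn_integral_cong)
      fix q
      have "ennreal (exp (- x q)) * ennreal (\<gamma> ^ n) = ennreal (\<gamma> ^ Suc n) * ennreal (exp (- x q) / \<gamma>)"
        using \<gamma> by (simp flip: ennreal_mult add: field_simps)
      then show "ennreal (exp (- x q)) * (ennreal (\<gamma> ^ n) * (\<integral>\<^sup>+\<omega>. ?G q \<omega> \<partial>T.S))
        = ennreal (\<gamma> ^ Suc n) * (ennreal (exp (- x q) / \<gamma>) * (\<integral>\<^sup>+\<omega>. ?G q \<omega> \<partial>T.S))"
        by (simp add: mult.assoc[symmetric])
    qed
    also have "\<dots> = ennreal (\<gamma> ^ Suc n) * (\<integral>\<^sup>+q. \<integral>\<^sup>+\<omega>. ?G q \<omega> \<partial>T.S \<partial>T)"
      unfolding T_eq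
      by (subst nn_integral_density) (simp_all add: nn_integral_cmult T_eq[symmetric])
    also have "(\<integral>\<^sup>+q. \<integral>\<^sup>+\<omega>. ?G q \<omega> \<partial>T.S \<partial>T)
      = (\<integral>\<^sup>+\<omega>. G (discount x \<omega> (Suc n), perpetuity x e \<omega> (Suc n)) \<partial>T.S)"
      by (subst T.nn_integral_split_first) (auto simp: discount_case_nat perpetuity_case_nat)
    finally show ?case .
  qed
qed

section \<open>Perpetuities with positive drift\<close>

text \<open>
Truncating the increment at \<open>m = min 1 d\<close> keeps the new denominator below \<open>2 (a + b)\<close>, so the bound
factors into a function of \<open>d\<close> and a function of \<open>(a, b)\<close>.
\<close>

lemma gap_le_new_coordinate:
  fixes a b d :: real
  assumes "0 < a" "0 \<le> b" "1 \<le> a + b" "0 < d"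
  shows "1/4 * (min 1 d * (a / (a + b)^2)) \<le> 1 / (1 + b) - 1 / (1 + (b + d * a))"
proof -
  define m where "m = min 1 d"
  have m: "0 < m" "m \<le> 1" "m \<le> d" using assms by (auto simp: m_def)
  have "1/4 * (m * (a / (a + b)^2)) = m * a / (2 * (a + b))^2"
    by (simp add: power2_eq_square field_simps)
  also have "\<dots> \<le> m * a / ((1 + b) * (1 + (b + m * a)))"
  proof (rule divide_left_mono)
    have "m * a \<le> 1 * a" using m assms by (intro mult_right_mono) auto
    then have "1 + (b + m * a) \<le> 2 * (a + b)" using assms(2,3) by argo
    then show "(1 + b) * (1 + (b + m * a)) \<le> (2 * (a + b))\<^sup>2"
      unfolding power2_eq_square using assms m by (intro mult_mono) auto
    show "0 < (2 * (a + b))\<^sup>2 * ((1 + b) * (1 + (b + m * a)))"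
      using assms m by (auto intro!: mult_pos_pos add_pos_nonneg)
  qed (use m assms in auto)
  also have "\<dots> = 1 / (1 + b) - 1 / (1 + (b + m * a))"
  proof -
    have "1 + b \<noteq> 0" "1 + (b + m * a) \<noteq> 0"
      using assms m by (auto simp: add_nonneg_eq_0_iff add_pos_nonneg)
    then show ?thesis by (simp add: field_simps)
  qed
  also have "\<dots> \<le> 1 / (1 + b) - 1 / (1 + (b + d * a))"
    using assms m by (auto intro!: divide_left_mono mult_right_mono mult_pos_pos add_pos_nonneg)
  finally show ?thesis by (simp add: m_def)
qed

text \<open>
The quotient is \<open>(b / (a + b))\<^bsup>j\<^esup> / (a + b)\<^sup>2\<close>; the last estimate is the inequality of Bernoulli for the power.
\<close>

lemma power_ratio_bounds:
  fixes a b :: real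
  assumes "0 < a" "0 \<le> b" "1 \<le> a + b"
  shows "0 \<le> b ^ j / (a + b) ^ (j + 2)" "b ^ j / (a + b) ^ (j + 2) \<le> 1 / (a + b)^2"
    "1 / (a + b)^2 - b ^ j / (a + b) ^ (j + 2) \<le> j * (a / (a + b)^2)"
proof -
  have eq: "b ^ j / (a + b) ^ (j + 2) = (b / (a + b)) ^ j * (1 / (a + b)^2)"
    by (simp add: power_divide power_add power2_eq_square)
  have r: "0 \<le> b / (a + b)" "b / (a + b) \<le> 1" using assms by (auto simp: divide_le_eq_1)
  show "0 \<le> b ^ j / (a + b) ^ (j + 2)" using assms by simp
  show "b ^ j / (a + b) ^ (j + 2) \<le> 1 / (a + b)^2"
    unfolding eq using r by (intro mult_left_le_one_le) (auto intro: power_le_one)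
  have "1 - j * a \<le> 1 + j * (b / (a + b) - 1)"
  proof -
    have "1 - b / (a + b) = a / (a + b)" using assms by (simp add: field_simps)
    also have "\<dots> \<le> a" using assms by (simp add: divide_le_eq)
    finally have "j * (1 - b / (a + b)) \<le> j * a" by (intro mult_left_mono) auto
    then show ?thesis by (simp add: algebra_simps)
  qed
  also have "\<dots> \<le> (b / (a + b)) ^ j"
    using Bernoulli_inequality[of "b / (a + b) - 1" j] r by simp
  finally have "1 - (b / (a + b)) ^ j \<le> j * a" by simp
  then have "(1 - (b / (a + b)) ^ j) * (1 / (a + b)^2) \<le> j * a * (1 / (a + b)^2)"
    by (rule mult_right_mono) simp
  then show "1 / (a + b)^2 - b ^ j / (a + b) ^ (j + 2) \<le> j * (a / (a + b)^2)"
    unfolding eq by (simp add: left_diff_distrib mult.assoc diff_divide_distrib)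
qed

text \<open>
The model case is \<open>x = log m(q)\<close> and \<open>e = p / (1 - a)\<close> under the tilted law, for which
\<open>exp (- x) + e = 1 / (1 - q(0))\<close>: the last assumption is then the integrability of \<open>ln (1 - q(0))\<close>.
\<close>

locale drifting_perpetuity = sequence_space T for T :: "'a measure" +
  fixes x e :: "'a \<Rightarrow> real"
  assumes measurable_x [measurable]: "x \<in> borel_measurable T"
    and measurable_e [measurable]: "e \<in> borel_measurable T"
    and e_pos: "AE q in T. 0 < e q"
    and step_ge_1: "AE q in T. 1 \<le> exp (- x q) + e q"
    and integrable_x: "integrable T x"
    and drift: "0 < (\<integral>q. x q \<partial>T)"
    and integrable_ln_step: "integrable T (\<lambda>q. ln (exp (- x q) + e q))"
begin

abbreviation A :: "(nat \<Rightarrow> 'a) \<Rightarrow> nat \<Rightarrow> real" where "A \<equiv> discount x"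
abbreviation B :: "(nat \<Rightarrow> 'a) \<Rightarrow> nat \<Rightarrow> real" where "B \<equiv> perpetuity x e"

lemma AE_coordinates: "AE \<omega> in S. \<forall>i. 0 < e (\<omega> i) \<and> 1 \<le> exp (- x (\<omega> i)) + e (\<omega> i)"
proof -
  have "AE \<omega> in S. 0 < e (\<omega> i) \<and> 1 \<le> exp (- x (\<omega> i)) + e (\<omega> i)" for i
    using e_pos step_ge_1
    by (intro AE_PiM_component[where P="\<lambda>q. 0 < e q \<and> 1 \<le> exp (- x q) + e q"])
       (auto intro: M.prob_space_axioms)
  then show ?thesis by (simp add: AE_all_countable)
qed

lemma AE_perpetuity_bounds:
  "AE \<omega> in S. \<forall>n. 0 \<le> B \<omega> n \<and> B \<omega> n \<le> B \<omega> (Suc n) \<and>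
     A \<omega> n + B \<omega> n \<le> A \<omega> (Suc n) + B \<omega> (Suc n) \<and> 1 \<le> A \<omega> n + B \<omega> n"
  using AE_coordinates by eventually_elim (use perpetuity_bounds in blast)

lemma integrable_bounded_by_1:
  assumes [measurable]: "f \<in> borel_measurable S" and "AE \<omega> in S. 0 \<le> f \<omega> \<and> f \<omega> \<le> (1::real)"
  shows "integrable S f"
  using assms(2) by (intro P.integrable_const_bound[where B=1]) auto

lemma ratio_integrable: "integrable S (\<lambda>\<omega>. A \<omega> n / (A \<omega> n + B \<omega> n)^2)"
proof (rule integrable_bounded_by_1)
  show "AE \<omega> in S. 0 \<le> A \<omega> n / (A \<omega> n + B \<omega> n)^2 \<and> A \<omega> n / (A \<omega> n + B \<omega> n)^2 \<le> 1"
    using AE_perpetuity_bounds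
  proof eventually_elim
    case (elim \<omega>)
    then have "0 \<le> B \<omega> n" "1 \<le> A \<omega> n + B \<omega> n" by auto
    then have "A \<omega> n \<le> (A \<omega> n + B \<omega> n) * 1" "(A \<omega> n + B \<omega> n) * 1 \<le> (A \<omega> n + B \<omega> n)^2"
      unfolding power2_eq_square by (auto intro: mult_left_mono)
    then have "A \<omega> n \<le> (A \<omega> n + B \<omega> n)^2" by linarith
    then show ?case using \<open>1 \<le> A \<omega> n + B \<omega> n\<close> by (auto simp: divide_le_eq_1)
  qed
qed measurable

text \<open>
Let \<open>b n\<close> be the expectation of \<open>1 / (1 + B)\<close>. It is decreasing and bounded below, so \<open>b n - b (n + 1)\<close> tends to
\<open>0\<close>. By independence of the new coordinate, that difference is at least \<open>1/4\<close> times the expectation of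
\<open>min 1 e\<close>, which is positive, times the expectation in question.
\<close>

lemma ratio_tendsto_0: "(\<lambda>n. \<integral>\<omega>. A \<omega> n / (A \<omega> n + B \<omega> n)^2 \<partial>S) \<longlonglongrightarrow> 0"
proof -
  define \<epsilon> where "\<epsilon> = (\<integral>q. min 1 (e q) \<partial>T)"
  define b where "b n = (\<integral>\<omega>. 1 / (1 + B \<omega> n) \<partial>S)" for n
  define r where "r n = (\<integral>\<omega>. A \<omega> n / (A \<omega> n + B \<omega> n)^2 \<partial>S)" for n
  have int_min: "integrable T (\<lambda>q. min 1 (e q))"
    using e_pos by (intro M.integrable_const_bound[where B=1]) auto
  have "\<epsilon> > 0"
  proof -
    have "\<epsilon> \<ge> 0" unfolding \<epsilon>_def by (rule integral_nonneg_AE) (use e_pos in auto)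
    moreover have "\<epsilon> \<noteq> 0"
    proof
      assume "\<epsilon> = 0"
      then have "AE q in T. min 1 (e q) = 0"
        unfolding \<epsilon>_def using e_pos
        by (subst (asm) integral_nonneg_eq_0_iff_AE[OF int_min]) auto
      with e_pos have "AE q in T. False" by eventually_elim (auto simp: min_def split: if_splits)
      then show False using M.AE_False by simp
    qed
    ultimately show ?thesis by simp
  qed
  have int_b: "integrable S (\<lambda>\<omega>. 1 / (1 + B \<omega> n))" for n
    by (rule integrable_bounded_by_1, measurable, use AE_perpetuity_bounds in eventually_elim)
       (simp add: add_pos_nonneg)
  have b_Suc: "b (Suc n) \<le> b n" for n
    unfolding b_def
    by (rule integral_mono_AE[OF int_b int_b], use AE_perpetuity_bounds in eventually_elim)
       (auto intro!: divide_left_mono mult_pos_pos add_pos_nonneg)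
  have b_nonneg: "0 \<le> b n" for n
    unfolding b_def
    by (rule integral_nonneg_AE, use AE_perpetuity_bounds in eventually_elim) auto
  have "decseq b" using b_Suc by (rule decseq_SucI)
  then obtain L where L: "b \<longlonglongrightarrow> L"
    using decseq_convergent[of b 0] b_nonneg by blast
  have gap0: "(\<lambda>n. b n - b (Suc n)) \<longlonglongrightarrow> 0"
    using tendsto_diff[OF L LIMSEQ_Suc[OF L]] by simp
  have ind: "(\<integral>\<omega>. min 1 (e (\<omega> n)) * (A \<omega> n / (A \<omega> n + B \<omega> n)^2) \<partial>S) = \<epsilon> * r n" for n
  proof -
    have "(\<integral>\<omega>. min 1 (e (\<omega> n)) * (A \<omega> n / (A \<omega> n + B \<omega> n)^2) \<partial>S)
      = enn2real (\<integral>\<^sup>+\<omega>. ennreal (min 1 (e (\<omega> n)) * (A \<omega> n / (A \<omega> n + B \<omega> n)^2)) \<partial>S)"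
      by (rule integral_eq_nn_integral, measurable, use AE_coordinates in eventually_elim)
         (auto intro!: mult_nonneg_nonneg simp: less_imp_le)
    also have "(\<integral>\<^sup>+\<omega>. ennreal (min 1 (e (\<omega> n)) * (A \<omega> n / (A \<omega> n + B \<omega> n)^2)) \<partial>S)
      = (\<integral>\<^sup>+\<omega>. \<integral>\<^sup>+q. ennreal (min 1 (e q) * (A \<omega> n / (A \<omega> n + B \<omega> n)^2)) \<partial>T \<partial>S)"
      using nn_integral_new_coordinate[of x e "\<lambda>(a, b, q). ennreal (min 1 (e q) * (a / (a + b)^2))" n]
      by simp
    also have "\<dots> = (\<integral>\<^sup>+\<omega>. ennreal (\<epsilon> * (A \<omega> n / (A \<omega> n + B \<omega> n)^2)) \<partial>S)"
    proof (rule nn_integral_cong)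
      fix \<omega>
      have "(\<integral>\<^sup>+q. ennreal (min 1 (e q) * (A \<omega> n / (A \<omega> n + B \<omega> n)^2)) \<partial>T)
        = ennreal (\<integral>q. min 1 (e q) * (A \<omega> n / (A \<omega> n + B \<omega> n)^2) \<partial>T)"
        by (rule nn_integral_eq_integral) (use int_min e_pos in auto)
      then show "(\<integral>\<^sup>+q. ennreal (min 1 (e q) * (A \<omega> n / (A \<omega> n + B \<omega> n)^2)) \<partial>T)
        = ennreal (\<epsilon> * (A \<omega> n / (A \<omega> n + B \<omega> n)^2))"
        by (simp add: \<epsilon>_def)
    qed
    also have "enn2real \<dots> = (\<integral>\<omega>. \<epsilon> * (A \<omega> n / (A \<omega> n + B \<omega> n)^2) \<partial>S)"
      by (rule integral_eq_nn_integral[symmetric]) (use \<open>\<epsilon> > 0\<close> in auto)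
    finally show ?thesis by (simp add: r_def del: times_divide_eq_right)
  qed
  have int_ind: "integrable S (\<lambda>\<omega>. min 1 (e (\<omega> n)) * (A \<omega> n / (A \<omega> n + B \<omega> n)^2))" for n
  proof (rule Bochner_Integration.integrable_bound[OF ratio_integrable[of n]])
    show "AE \<omega> in S. norm (min 1 (e (\<omega> n)) * (A \<omega> n / (A \<omega> n + B \<omega> n)^2))
      \<le> norm (A \<omega> n / (A \<omega> n + B \<omega> n)^2)"
      using AE_coordinates
    proof eventually_elim
      case (elim \<omega>)
      then have "0 < e (\<omega> n)" by blast
      then have "\<bar>min 1 (e (\<omega> n))\<bar> \<le> 1" by simp
      then show ?case
        unfolding real_norm_def abs_mult by (rule mult_left_le_one_le[rotated 2]) auto
    qed
  qed measurable
  have le: "1/4 * (\<epsilon> * r n) \<le> b n - b (Suc n)" for n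
  proof -
    have "1/4 * (\<epsilon> * r n) = (\<integral>\<omega>. 1/4 * (min 1 (e (\<omega> n)) * (A \<omega> n / (A \<omega> n + B \<omega> n)^2)) \<partial>S)"
      by (simp add: ind del: times_divide_eq_right)
    also have "\<dots> \<le> (\<integral>\<omega>. 1 / (1 + B \<omega> n) - 1 / (1 + B \<omega> (Suc n)) \<partial>S)"
    proof (rule integral_mono_AE)
      show "integrable S (\<lambda>\<omega>. 1/4 * (min 1 (e (\<omega> n)) * (A \<omega> n / (A \<omega> n + B \<omega> n)^2)))"
        using int_ind[of n] by (rule integrable_mult_right)
      show "integrable S (\<lambda>\<omega>. 1 / (1 + B \<omega> n) - 1 / (1 + B \<omega> (Suc n)))"
        using int_b by (intro Bochner_Integration.integrable_diff)
      show "AE \<omega> in S. 1/4 * (min 1 (e (\<omega> n)) * (A \<omega> n / (A \<omega> n + B \<omega> n)^2))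
        \<le> 1 / (1 + B \<omega> n) - 1 / (1 + B \<omega> (Suc n))"
        using AE_coordinates AE_perpetuity_bounds
        by eventually_elim (unfold perpetuity_Suc, rule gap_le_new_coordinate, auto)
    qed
    also have "\<dots> = b n - b (Suc n)"
      by (simp add: b_def int_b)
    finally show ?thesis .
  qed
  have "r \<longlonglongrightarrow> 0"
  proof (rule tendsto_sandwich[OF always_eventually always_eventually tendsto_const])
    show "\<forall>n. 0 \<le> r n" unfolding r_def by (auto intro!: Bochner_Integration.integral_nonneg)
    show "\<forall>n. r n \<le> 4 / \<epsilon> * (b n - b (Suc n))"
      using le \<open>\<epsilon> > 0\<close> by (auto simp: field_simps)
    show "(\<lambda>n. 4 / \<epsilon> * (b n - b (Suc n))) \<longlonglongrightarrow> 0"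
      using tendsto_mult_left[OF gap0, of "4 / \<epsilon>"] by simp
  qed
  then show ?thesis unfolding r_def [abs_def] .
qed

lemma perpetuity_ge_1: "AE \<omega> in S. \<forall>n. 1 \<le> A \<omega> n + B \<omega> n"
  using AE_perpetuity_bounds by eventually_elim auto

lemma inverse_square_bounds: "AE \<omega> in S. \<forall>n. 0 \<le> 1 / (A \<omega> n + B \<omega> n)^2 \<and> 1 / (A \<omega> n + B \<omega> n)^2 \<le> 1"
  using perpetuity_ge_1 by eventually_elim (auto simp: divide_le_eq_1 intro: one_le_power)

lemma integrable_inverse_square: "integrable S (\<lambda>\<omega>. 1 / (A \<omega> n + B \<omega> n)^2)"
  by (rule integrable_bounded_by_1, measurable, use inverse_square_bounds in eventually_elim) auto

lemma inverse_square_antimono: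
  "(\<integral>\<omega>. 1 / (A \<omega> (Suc n) + B \<omega> (Suc n))^2 \<partial>S) \<le> (\<integral>\<omega>. 1 / (A \<omega> n + B \<omega> n)^2 \<partial>S)"
proof (rule integral_mono_AE[OF integrable_inverse_square integrable_inverse_square],
       use AE_perpetuity_bounds in eventually_elim)
  case (elim \<omega>)
  then have "1 \<le> A \<omega> n + B \<omega> n" "A \<omega> n + B \<omega> n \<le> A \<omega> (Suc n) + B \<omega> (Suc n)" by auto
  then show ?case by (intro divide_left_mono power_mono mult_pos_pos zero_less_power) auto
qed

text \<open>
The measure \<open>T \<Otimes>\<^sub>M S\<close> is the law of head and tail of an i.i.d. sequence: the sequence itself, its
head and its tail are measure preserving images of it.
\<close>

lemma distr_snd: "distr (T \<Otimes>\<^sub>M S) S snd = S"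
proof (rule measure_eqI)
  fix E assume "E \<in> sets (distr (T \<Otimes>\<^sub>M S) S snd)"
  then have [measurable]: "E \<in> sets S" by simp
  then have "snd -` E \<inter> space (T \<Otimes>\<^sub>M S) = space T \<times> E"
    using sets.sets_into_space[of E S] by (auto simp: space_pair_measure)
  then show "emeasure (distr (T \<Otimes>\<^sub>M S) S snd) E = emeasure S E"
    by (simp add: emeasure_distr P.emeasure_pair_measure_Times M.emeasure_space_1)
qed simp

lemma distr_fst: "distr (T \<Otimes>\<^sub>M S) T fst = T"
  by (rule P.distr_pair_fst)

lemma integrable_of_second:
  fixes f :: "(nat \<Rightarrow> 'a) \<Rightarrow> real"
  assumes [measurable]: "integrable S f"
  shows "integrable (T \<Otimes>\<^sub>M S) (\<lambda>(q, \<omega>). f \<omega>)" and "(\<integral>(q, \<omega>). f \<omega> \<partial>(T \<Otimes>\<^sub>M S)) = (\<integral>\<omega>. f \<omega> \<partial>S)"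
proof -
  have eq: "distr (T \<Otimes>\<^sub>M S) S snd = S"
    by (rule distr_snd)
  have "integrable (distr (T \<Otimes>\<^sub>M S) S snd) f" using assms by (simp add: eq)
  then show "integrable (T \<Otimes>\<^sub>M S) (\<lambda>(q, \<omega>). f \<omega>)"
    by (subst (asm) integrable_distr_eq) (auto simp: case_prod_beta')
  have "(\<integral>\<omega>. f \<omega> \<partial>S) = (\<integral>\<omega>. f \<omega> \<partial>distr (T \<Otimes>\<^sub>M S) S snd)" by (simp add: eq)
  also have "\<dots> = (\<integral>(q, \<omega>). f \<omega> \<partial>(T \<Otimes>\<^sub>M S))"
    by (subst integral_distr) (auto simp: case_prod_beta')
  finally show "(\<integral>(q, \<omega>). f \<omega> \<partial>(T \<Otimes>\<^sub>M S)) = (\<integral>\<omega>. f \<omega> \<partial>S)" by simp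
qed

lemma integrable_case_nat:
  fixes f :: "(nat \<Rightarrow> 'a) \<Rightarrow> real"
  assumes [measurable]: "f \<in> borel_measurable S"
  shows "integrable S f \<longleftrightarrow> integrable (T \<Otimes>\<^sub>M S) (\<lambda>(q, \<omega>). f (case_nat q \<omega>))"
    and "(\<integral>\<omega>. f \<omega> \<partial>S) = (\<integral>(q, \<omega>). f (case_nat q \<omega>) \<partial>(T \<Otimes>\<^sub>M S))"
proof -
  have "integrable S f \<longleftrightarrow> integrable (distr (T \<Otimes>\<^sub>M S) S (\<lambda>(s, \<omega>). case_nat s \<omega>)) f"
    by (simp add: PiM_iter)
  also have "\<dots> \<longleftrightarrow> integrable (T \<Otimes>\<^sub>M S) (\<lambda>(q, \<omega>). f (case_nat q \<omega>))"
    by (subst integrable_distr_eq) (auto simp: case_prod_beta')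
  finally show "integrable S f \<longleftrightarrow> integrable (T \<Otimes>\<^sub>M S) (\<lambda>(q, \<omega>). f (case_nat q \<omega>))" .
  have "(\<integral>\<omega>. f \<omega> \<partial>S) = (\<integral>\<omega>. f \<omega> \<partial>distr (T \<Otimes>\<^sub>M S) S (\<lambda>(s, \<omega>). case_nat s \<omega>))"
    by (simp add: PiM_iter)
  also have "\<dots> = (\<integral>(q, \<omega>). f (case_nat q \<omega>) \<partial>(T \<Otimes>\<^sub>M S))"
    by (subst integral_distr) (auto simp: case_prod_beta')
  finally show "(\<integral>\<omega>. f \<omega> \<partial>S) = (\<integral>(q, \<omega>). f (case_nat q \<omega>) \<partial>(T \<Otimes>\<^sub>M S))" .
qed

lemma AE_pair_of_first:
  assumes "AE q in T. P q"
  shows "AE (q, \<omega>) in T \<Otimes>\<^sub>M S. P q"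
proof -
  have "AE q in distr (T \<Otimes>\<^sub>M S) T fst. P q" unfolding distr_fst by (rule assms)
  then show ?thesis unfolding case_prod_beta' by (rule AE_distrD[OF measurable_fst])
qed

lemma AE_pair_of_second:
  assumes "AE \<omega> in S. P \<omega>"
  shows "AE (q, \<omega>) in T \<Otimes>\<^sub>M S. P \<omega>"
proof -
  have "AE q in distr (T \<Otimes>\<^sub>M S) S snd. P q" unfolding distr_snd by (rule assms)
  then show ?thesis unfolding case_prod_beta' by (rule AE_distrD[OF measurable_snd])
qed

lemma integrable_of_first:
  fixes f :: "'a \<Rightarrow> real"
  assumes [measurable]: "integrable T f"
  shows "integrable (T \<Otimes>\<^sub>M S) (\<lambda>(q, \<omega>). f q)" "(\<integral>(q, \<omega>). f q \<partial>(T \<Otimes>\<^sub>M S)) = (\<integral>q. f q \<partial>T)"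
proof -
  have eq: "distr (T \<Otimes>\<^sub>M S) T fst = T"
    by (rule distr_fst)
  have "integrable (distr (T \<Otimes>\<^sub>M S) T fst) f" using assms by (simp add: eq)
  then show "integrable (T \<Otimes>\<^sub>M S) (\<lambda>(q, \<omega>). f q)"
    by (subst (asm) integrable_distr_eq) (auto simp: case_prod_beta')
  have "(\<integral>\<omega>. f \<omega> \<partial>T) = (\<integral>\<omega>. f \<omega> \<partial>distr (T \<Otimes>\<^sub>M S) T fst)" by (simp add: eq)
  also have "\<dots> = (\<integral>(q, \<omega>). f q \<partial>(T \<Otimes>\<^sub>M S))"
    by (subst integral_distr) (auto simp: case_prod_beta')
  finally show "(\<integral>(q, \<omega>). f q \<partial>(T \<Otimes>\<^sub>M S)) = (\<integral>q. f q \<partial>T)" by simp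
qed

text \<open>
These bounds hold uniformly in \<open>v\<close>, which stands for the reciprocal of \<open>A + B\<close>; both are
integrable, and they serve as majorants in the limit below.
\<close>

lemma first_step_log_bounds:
  assumes "0 < e q" "1 \<le> exp (- x q) + e q" "0 \<le> v" "v \<le> 1"
  shows "- x q \<le> ln (exp (- x q) + e q * v)" "ln (exp (- x q) + e q * v) \<le> ln (exp (- x q) + e q)"
proof -
  have "ln (exp (- x q)) \<le> ln (exp (- x q) + e q * v)"
    using assms by (subst ln_le_cancel_iff) (auto intro!: add_pos_nonneg)
  then show "- x q \<le> ln (exp (- x q) + e q * v)" by simp
  show "ln (exp (- x q) + e q * v) \<le> ln (exp (- x q) + e q)"
    using assms by (subst ln_le_cancel_iff) (auto intro!: add_pos_nonneg mult_left_le)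
qed

lemma ln_first_step:
  assumes "1 \<le> A \<omega> n + B \<omega> n" "0 < e q"
  shows "ln (A (case_nat q \<omega>) (Suc n) + B (case_nat q \<omega>) (Suc n))
    = ln (A \<omega> n + B \<omega> n) + ln (exp (- x q) + e q * (1 / (A \<omega> n + B \<omega> n)))"
proof -
  have "A (case_nat q \<omega>) (Suc n) + B (case_nat q \<omega>) (Suc n)
    = (A \<omega> n + B \<omega> n) * (exp (- x q) + e q * (1 / (A \<omega> n + B \<omega> n)))"
    using assms by (simp add: discount_case_nat perpetuity_case_nat field_simps)
  then show ?thesis
    using assms by (subst ln_mult_pos[symmetric]) (auto intro!: add_pos_nonneg)
qed

lemma measurable_ln_first_step [measurable]:
  "(\<lambda>(q, \<omega>). ln (A (case_nat q \<omega>) (Suc n) + B (case_nat q \<omega>) (Suc n)))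
     \<in> borel_measurable (T \<Otimes>\<^sub>M S)"
  unfolding discount_case_nat perpetuity_case_nat by measurable

lemma AE_first_step:
  "AE (q, \<omega>) in T \<Otimes>\<^sub>M S. 0 < e q \<and> 1 \<le> exp (- x q) + e q \<and>
     (\<forall>n. 1 \<le> A \<omega> n + B \<omega> n \<and> - x q \<le> ln (exp (- x q) + e q * (1 / (A \<omega> n + B \<omega> n))) \<and>
        ln (exp (- x q) + e q * (1 / (A \<omega> n + B \<omega> n))) \<le> ln (exp (- x q) + e q))"
  using AE_pair_of_first[OF e_pos] AE_pair_of_first[OF step_ge_1] AE_pair_of_second[OF perpetuity_ge_1]
proof eventually_elim
  case (elim y)
  obtain q \<omega> where [simp]: "y = (q, \<omega>)" by (cases y)
  have "0 < e q" "1 \<le> exp (- x q) + e q" "\<And>n. 1 \<le> A \<omega> n + B \<omega> n" using elim by auto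
  moreover have "0 \<le> 1 / (A \<omega> n + B \<omega> n)" "1 / (A \<omega> n + B \<omega> n) \<le> 1" for n
    using calculation(3)[of n] by auto
  ultimately show ?case
    using first_step_log_bounds[of q] by (simp del: times_divide_eq_right mult_1_right)
qed

lemma AE_ln_first_step:
  "AE y in T \<Otimes>\<^sub>M S. (case y of (q, \<omega>) \<Rightarrow> ln (A \<omega> n + B \<omega> n))
     + (case y of (q, \<omega>) \<Rightarrow> ln (exp (- x q) + e q * (1 / (A \<omega> n + B \<omega> n))))
   = (case y of (q, \<omega>) \<Rightarrow> ln (A (case_nat q \<omega>) (Suc n) + B (case_nat q \<omega>) (Suc n)))"
  using AE_first_step
proof eventually_elim
  case (elim y)
  obtain q \<omega> where [simp]: "y = (q, \<omega>)" by (cases y)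
  have "1 \<le> A \<omega> n + B \<omega> n" "0 < e q" using elim by auto
  from ln_first_step[OF this] show ?case by simp
qed

lemma integrable_first_step:
  "integrable (T \<Otimes>\<^sub>M S) (\<lambda>(q, \<omega>). ln (exp (- x q) + e q * (1 / (A \<omega> n + B \<omega> n))))"
proof (rule Bochner_Integration.integrable_bound)
  show "integrable (T \<Otimes>\<^sub>M S) (\<lambda>y. (case y of (q, \<omega>) \<Rightarrow> \<bar>x q\<bar>) + (case y of (q, \<omega>) \<Rightarrow> \<bar>ln (exp (- x q) + e q)\<bar>))"
    using integrable_x integrable_ln_step
    by (intro Bochner_Integration.integrable_add integrable_of_first integrable_abs)
  show "AE y in T \<Otimes>\<^sub>M S. norm (case y of (q, \<omega>) \<Rightarrow> ln (exp (- x q) + e q * (1 / (A \<omega> n + B \<omega> n))))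
    \<le> norm ((case y of (q, \<omega>) \<Rightarrow> \<bar>x q\<bar>) + (case y of (q, \<omega>) \<Rightarrow> \<bar>ln (exp (- x q) + e q)\<bar>))"
    using AE_first_step
  proof eventually_elim
    case (elim y)
    obtain q \<omega> where [simp]: "y = (q, \<omega>)" by (cases y)
    have "- x q \<le> ln (exp (- x q) + e q * (1 / (A \<omega> n + B \<omega> n)))"
      "ln (exp (- x q) + e q * (1 / (A \<omega> n + B \<omega> n))) \<le> ln (exp (- x q) + e q)"
      using elim by auto
    then show ?case by simp
  qed
qed measurable

lemma integrable_ln_perpetuity: "integrable S (\<lambda>\<omega>. ln (A \<omega> n + B \<omega> n))"
proof (induction n)
  case (Suc n)
  have "integrable (T \<Otimes>\<^sub>M S) (\<lambda>y. (case y of (q, \<omega>) \<Rightarrow> ln (A \<omega> n + B \<omega> n))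
     + (case y of (q, \<omega>) \<Rightarrow> ln (exp (- x q) + e q * (1 / (A \<omega> n + B \<omega> n)))))"
    by (intro Bochner_Integration.integrable_add integrable_of_second integrable_first_step Suc.IH)
  also have "?this \<longleftrightarrow> integrable (T \<Otimes>\<^sub>M S)
      (\<lambda>(q, \<omega>). ln (A (case_nat q \<omega>) (Suc n) + B (case_nat q \<omega>) (Suc n)))"
    by (intro integrable_cong_AE AE_ln_first_step measurable_ln_first_step) measurable
  finally show ?case by (subst integrable_case_nat) auto
qed simp

text \<open>
The integral is the increment of the expectation of \<open>ln (A + B)\<close>: head and tail decomposition writes
\<open>ln (A + B)\<close> at time \<open>n + 1\<close> as the same quantity at time \<open>n\<close> for the tail, plus the integrand.
\<close>

lemma first_step_nonneg:
  "0 \<le> (\<integral>(q, \<omega>). ln (exp (- x q) + e q * (1 / (A \<omega> n + B \<omega> n))) \<partial>(T \<Otimes>\<^sub>M S))"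
proof -
  have "(\<integral>\<omega>. ln (A \<omega> (Suc n) + B \<omega> (Suc n)) \<partial>S)
    = (\<integral>(q, \<omega>). ln (A (case_nat q \<omega>) (Suc n) + B (case_nat q \<omega>) (Suc n)) \<partial>(T \<Otimes>\<^sub>M S))"
    by (rule integrable_case_nat) measurable
  also have "\<dots> = (\<integral>y. (case y of (q, \<omega>) \<Rightarrow> ln (A \<omega> n + B \<omega> n))
     + (case y of (q, \<omega>) \<Rightarrow> ln (exp (- x q) + e q * (1 / (A \<omega> n + B \<omega> n)))) \<partial>(T \<Otimes>\<^sub>M S))"
    by (intro integral_cong_AE AE_symmetric[OF AE_ln_first_step] measurable_ln_first_step) measurable
  also have "\<dots> = (\<integral>\<omega>. ln (A \<omega> n + B \<omega> n) \<partial>S)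
     + (\<integral>(q, \<omega>). ln (exp (- x q) + e q * (1 / (A \<omega> n + B \<omega> n))) \<partial>(T \<Otimes>\<^sub>M S))"
    using integrable_of_second[OF integrable_ln_perpetuity] integrable_first_step
    by (subst Bochner_Integration.integral_add) auto
  finally have *: "(\<integral>\<omega>. ln (A \<omega> (Suc n) + B \<omega> (Suc n)) \<partial>S) = \<dots>" .
  have "(\<integral>\<omega>. ln (A \<omega> n + B \<omega> n) \<partial>S) \<le> (\<integral>\<omega>. ln (A \<omega> (Suc n) + B \<omega> (Suc n)) \<partial>S)"
  proof (rule integral_mono_AE[OF integrable_ln_perpetuity integrable_ln_perpetuity],
         use AE_perpetuity_bounds in eventually_elim)
    case (elim \<omega>)
    then have "1 \<le> A \<omega> n + B \<omega> n" "A \<omega> n + B \<omega> n \<le> A \<omega> (Suc n) + B \<omega> (Suc n)" by auto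
    then show ?case by (intro ln_mono) auto
  qed
  with * show ?thesis by simp
qed

text \<open>
If the limit were \<open>0\<close>, then \<open>1 / (A + B)\<close> would decrease to \<open>V = 0\<close> almost surely, and the increments of the
expectation of \<open>ln (A + B)\<close>, which are nonnegative, would converge to the negative number \<open>- E [x]\<close>.
\<close>

lemma inverse_square_limit_pos:
  "\<exists>L>0. (\<lambda>n. \<integral>\<omega>. 1 / (A \<omega> n + B \<omega> n)^2 \<partial>S) \<longlonglongrightarrow> L"
proof -
  define h where "h n = (\<integral>\<omega>. 1 / (A \<omega> n + B \<omega> n)^2 \<partial>S)" for n
  have "decseq h" unfolding h_def by (intro decseq_SucI inverse_square_antimono)
  have h_nonneg: "0 \<le> h n" for n unfolding h_def by (rule Bochner_Integration.integral_nonneg) simp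
  obtain L where L: "h \<longlonglongrightarrow> L"
    using decseq_convergent[OF \<open>decseq h\<close>, of 0] h_nonneg by blast
  have "0 \<le> L" by (rule LIMSEQ_le_const[OF L]) (use h_nonneg in auto)
  moreover have "L \<noteq> 0"
  proof
    assume "L = 0"
    define V where "V \<omega> = Topological_Spaces.lim (\<lambda>n. 1 / (A \<omega> n + B \<omega> n))" for \<omega>
    have [measurable]: "V \<in> borel_measurable S" unfolding V_def by measurable
    have V: "AE \<omega> in S. (\<lambda>n. 1 / (A \<omega> n + B \<omega> n)) \<longlonglongrightarrow> V \<omega>"
      using AE_perpetuity_bounds
    proof eventually_elim
      case (elim \<omega>)
      have "decseq (\<lambda>n. 1 / (A \<omega> n + B \<omega> n))"
      proof (rule decseq_SucI)
        fix n
        have "1 \<le> A \<omega> n + B \<omega> n" "A \<omega> n + B \<omega> n \<le> A \<omega> (Suc n) + B \<omega> (Suc n)" using elim by auto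
        then show "1 / (A \<omega> (Suc n) + B \<omega> (Suc n)) \<le> 1 / (A \<omega> n + B \<omega> n)"
          by (intro divide_left_mono mult_pos_pos) auto
      qed
      moreover have "0 \<le> 1 / (A \<omega> n + B \<omega> n)" for n
        using elim by (simp add: add_nonneg_nonneg)
      ultimately have "convergent (\<lambda>n. 1 / (A \<omega> n + B \<omega> n))"
        by (intro Bseq_monoseq_convergent decseq_imp_monoseq decseq_bounded[where B=0]) auto
      then show ?case unfolding V_def by (simp add: convergent_LIMSEQ_iff)
    qed
    have "integrable S (\<lambda>\<omega>. (V \<omega>)^2)" and lim: "(\<lambda>n. \<integral>\<omega>. 1 / (A \<omega> n + B \<omega> n)^2 \<partial>S) \<longlonglongrightarrow> (\<integral>\<omega>. (V \<omega>)^2 \<partial>S)"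
    proof -
      have 1: "integrable S (\<lambda>\<omega>. 1 :: real)" by simp
      have 2: "AE \<omega> in S. (\<lambda>n. 1 / (A \<omega> n + B \<omega> n)^2) \<longlonglongrightarrow> (V \<omega>)^2"
        using V by eventually_elim (auto dest: tendsto_power[where n=2] simp: power_divide)
      have 3: "AE \<omega> in S. norm (1 / (A \<omega> n + B \<omega> n)^2) \<le> 1" for n
        using inverse_square_bounds by eventually_elim auto
      show "integrable S (\<lambda>\<omega>. (V \<omega>)^2)"
        by (rule integrable_dominated_convergence[OF _ _ 1 2 3]) measurable
      show "(\<lambda>n. \<integral>\<omega>. 1 / (A \<omega> n + B \<omega> n)^2 \<partial>S) \<longlonglongrightarrow> (\<integral>\<omega>. (V \<omega>)^2 \<partial>S)"
        by (rule integral_dominated_convergence[OF _ _ 1 2 3]) measurable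
    qed
    have "(\<integral>\<omega>. (V \<omega>)^2 \<partial>S) = 0"
      using LIMSEQ_unique[OF L[unfolded h_def] lim] \<open>L = 0\<close> by simp
    then have "AE \<omega> in S. V \<omega> = 0"
      using integral_nonneg_eq_0_iff_AE[OF \<open>integrable S (\<lambda>\<omega>. (V \<omega>)^2)\<close>] by simp
    with V have "AE \<omega> in S. (\<lambda>n. 1 / (A \<omega> n + B \<omega> n)) \<longlonglongrightarrow> 0"
      by eventually_elim simp
    note to0 = AE_pair_of_second[OF this]
    \<comment> \<open>Dominated convergence contradicts the nonnegativity of the increments.\<close>
    have "(\<lambda>n. \<integral>(q, \<omega>). ln (exp (- x q) + e q * (1 / (A \<omega> n + B \<omega> n))) \<partial>(T \<Otimes>\<^sub>M S))
      \<longlonglongrightarrow> (\<integral>(q, \<omega>). - x q \<partial>(T \<Otimes>\<^sub>M S))"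
    proof (rule integral_dominated_convergence)
      show "integrable (T \<Otimes>\<^sub>M S) (\<lambda>y. (case y of (q, \<omega>) \<Rightarrow> \<bar>x q\<bar>) + (case y of (q, \<omega>) \<Rightarrow> \<bar>ln (exp (- x q) + e q)\<bar>))"
        using integrable_x integrable_ln_step
        by (intro Bochner_Integration.integrable_add integrable_of_first integrable_abs)
      show "AE y in T \<Otimes>\<^sub>M S. norm (case y of (q, \<omega>) \<Rightarrow> ln (exp (- x q) + e q * (1 / (A \<omega> n + B \<omega> n))))
        \<le> (case y of (q, \<omega>) \<Rightarrow> \<bar>x q\<bar>) + (case y of (q, \<omega>) \<Rightarrow> \<bar>ln (exp (- x q) + e q)\<bar>)" for n
        using AE_first_step
      proof eventually_elim
        case (elim y)
        obtain q \<omega> where [simp]: "y = (q, \<omega>)" by (cases y)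
        have "- x q \<le> ln (exp (- x q) + e q * (1 / (A \<omega> n + B \<omega> n)))"
          "ln (exp (- x q) + e q * (1 / (A \<omega> n + B \<omega> n))) \<le> ln (exp (- x q) + e q)"
          using elim by auto
        then show ?case by simp
      qed
      show "AE y in T \<Otimes>\<^sub>M S. (\<lambda>n. case y of (q, \<omega>) \<Rightarrow> ln (exp (- x q) + e q * (1 / (A \<omega> n + B \<omega> n))))
        \<longlonglongrightarrow> (case y of (q, \<omega>) \<Rightarrow> - x q)"
        using to0
      proof eventually_elim
        case (elim y)
        obtain q \<omega> where [simp]: "y = (q, \<omega>)" by (cases y)
        have "(\<lambda>n. 1 / (A \<omega> n + B \<omega> n)) \<longlonglongrightarrow> 0" using elim by simp
        then have "(\<lambda>n. ln (exp (- x q) + e q * (1 / (A \<omega> n + B \<omega> n)))) \<longlonglongrightarrow> ln (exp (- x q) + e q * 0)"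
          by (intro tendsto_intros) auto
        then show ?case by simp
      qed
    qed measurable
    then have "0 \<le> (\<integral>(q, \<omega>). - x q \<partial>(T \<Otimes>\<^sub>M S))"
      by (rule LIMSEQ_le_const) (use first_step_nonneg in auto)
    also have "\<dots> = - (\<integral>q. x q \<partial>T)"
      using integrable_of_first(2)[of "\<lambda>q. - x q"] integrable_x by simp
    finally show False using drift by simp
  qed
  ultimately have "0 < L" by simp
  with L show ?thesis unfolding h_def by blast
qed

text \<open>
This will turn out to be \<open>P (Z\<^sub>n = k)\<close> divided by \<open>\<gamma>\<^bsup>n\<^esup>\<close>.
\<close>

definition tilted_weight :: "nat \<Rightarrow> nat \<Rightarrow> real" where
  "tilted_weight k n = (\<integral>\<omega>. B \<omega> n ^ (k - 1) / (A \<omega> n + B \<omega> n) ^ (k + 1) \<partial>S)"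

lemma AE_positivity: "AE \<omega> in S. 0 < A \<omega> n \<and> 0 \<le> B \<omega> n \<and> 1 \<le> A \<omega> n + B \<omega> n"
  using AE_perpetuity_bounds by eventually_elim auto

lemma integrable_power_ratio: "integrable S (\<lambda>\<omega>. B \<omega> n ^ j / (A \<omega> n + B \<omega> n) ^ (j + 2))"
proof (rule Bochner_Integration.integrable_bound[OF integrable_inverse_square[of n]])
  show "AE \<omega> in S. norm (B \<omega> n ^ j / (A \<omega> n + B \<omega> n) ^ (j + 2)) \<le> norm (1 / (A \<omega> n + B \<omega> n)^2)"
    using AE_positivity[of n]
  proof eventually_elim
    case (elim \<omega>)
    then show ?case using power_ratio_bounds[of "A \<omega> n" "B \<omega> n" j]
      by (simp del: power_Suc)
  qed
qed measurable

lemma nn_integral_tilted_weight: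
  assumes "1 \<le> k"
  shows "(\<integral>\<^sup>+\<omega>. ennreal (B \<omega> n ^ (k - 1) / (A \<omega> n + B \<omega> n) ^ (k + 1)) \<partial>S) = ennreal (tilted_weight k n)"
proof -
  have k: "k + 1 = (k - 1) + 2" using assms by simp
  show ?thesis unfolding tilted_weight_def k
  proof (rule nn_integral_eq_integral[OF integrable_power_ratio])
    show "AE \<omega> in S. 0 \<le> B \<omega> n ^ (k - 1) / (A \<omega> n + B \<omega> n) ^ (k - 1 + 2)"
      using AE_positivity[of n] by eventually_elim (rule power_ratio_bounds(1), auto)
  qed
qed

text \<open>
By the estimates for \<open>b\<^bsup>j\<^esup> / (a + b)\<^bsup>j+2\<^esup>\<close>, the weights differ from that for \<open>k = 1\<close> by at most a multiple of
the expectation in \<open>ratio_tendsto_0\<close>, so they all share the positive limit of that one.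
\<close>

lemma tilted_weight_limit: "\<exists>L>0. \<forall>k\<ge>1. tilted_weight k \<longlonglongrightarrow> L"
proof -
  obtain L where "L > 0" and L: "(\<lambda>n. \<integral>\<omega>. 1 / (A \<omega> n + B \<omega> n)^2 \<partial>S) \<longlonglongrightarrow> L"
    using inverse_square_limit_pos by blast
  have "tilted_weight (Suc j) \<longlonglongrightarrow> L" for j
  proof -
    note bounds = AE_positivity and int = integrable_power_ratio[where j=j]
    define d where "d n = (\<integral>\<omega>. 1 / (A \<omega> n + B \<omega> n)^2 \<partial>S) - tilted_weight (Suc j) n" for n
    have d: "d n = (\<integral>\<omega>. 1 / (A \<omega> n + B \<omega> n)^2 - B \<omega> n ^ j / (A \<omega> n + B \<omega> n) ^ (j + 2) \<partial>S)" for n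
      using int[of n] integrable_inverse_square[of n] by (simp add: d_def tilted_weight_def)
    have "d \<longlonglongrightarrow> 0"
    proof (rule tendsto_sandwich[OF always_eventually always_eventually tendsto_const])
      show "\<forall>n. 0 \<le> d n"
      proof
        fix n
        show "0 \<le> d n" unfolding d
          by (rule integral_nonneg_AE, use bounds[of n] in eventually_elim)
             (use power_ratio_bounds(2) in \<open>simp del: power_Suc\<close>)
      qed
      show "\<forall>n. d n \<le> j * (\<integral>\<omega>. A \<omega> n / (A \<omega> n + B \<omega> n)^2 \<partial>S)"
      proof
        fix n
        have "d n \<le> (\<integral>\<omega>. j * (A \<omega> n / (A \<omega> n + B \<omega> n)^2) \<partial>S)" unfolding d
        proof (rule integral_mono_AE)
          show "integrable S (\<lambda>\<omega>. 1 / (A \<omega> n + B \<omega> n)^2 - B \<omega> n ^ j / (A \<omega> n + B \<omega> n) ^ (j + 2))"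
            using integrable_inverse_square int by (intro Bochner_Integration.integrable_diff)
          show "integrable S (\<lambda>\<omega>. j * (A \<omega> n / (A \<omega> n + B \<omega> n)^2))"
            using ratio_integrable[of n] by (rule integrable_mult_right)
          show "AE \<omega> in S. 1 / (A \<omega> n + B \<omega> n)^2 - B \<omega> n ^ j / (A \<omega> n + B \<omega> n) ^ (j + 2)
            \<le> j * (A \<omega> n / (A \<omega> n + B \<omega> n)^2)"
            using bounds[of n] by eventually_elim (rule power_ratio_bounds(3), auto)
        qed
        then show "d n \<le> j * (\<integral>\<omega>. A \<omega> n / (A \<omega> n + B \<omega> n)^2 \<partial>S)"
          by (simp del: times_divide_eq_right)
      qed
      show "(\<lambda>n. j * (\<integral>\<omega>. A \<omega> n / (A \<omega> n + B \<omega> n)^2 \<partial>S)) \<longlonglongrightarrow> 0"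
        using tendsto_mult_left[OF ratio_tendsto_0, of "real j"] by simp
    qed
    from tendsto_diff[OF L this] show ?thesis by (simp add: d_def)
  qed
  then have "\<forall>k\<ge>1. tilted_weight k \<longlonglongrightarrow> L" by (metis Suc_le_D One_nat_def)
  with \<open>L > 0\<close> show ?thesis by blast
qed

end

section \<open>Generating functions of linear fractional laws\<close>

lemma space_offspring_laws [simp]: "space offspring_laws = UNIV"
  by (simp add: offspring_laws_def)

definition pgf :: "nat pmf \<Rightarrow> real \<Rightarrow> real" where
  "pgf q s = (\<Sum>j. pmf q j * s ^ j)"

lemma pgf_basics:
  assumes s: "0 \<le> s" "s \<le> 1"
  shows "(\<lambda>j. pmf q j * s ^ j) sums pgf q s" and "0 \<le> pgf q s" and "pgf q s \<le> 1"
    and "(\<integral>\<^sup>+j. ennreal (s ^ j) \<partial>measure_pmf q) = ennreal (pgf q s)"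
proof -
  have eq: "(\<integral>\<^sup>+j. ennreal (s ^ j) \<partial>measure_pmf q) = (\<Sum>j. ennreal (pmf q j * s ^ j))"
    using s by (simp add: nn_integral_measure_pmf nn_integral_count_space_nat ennreal_mult)
  have le: "(\<integral>\<^sup>+j. ennreal (s ^ j) \<partial>measure_pmf q) \<le> (\<integral>\<^sup>+j. 1 \<partial>measure_pmf q)"
    using s by (intro nn_integral_mono) (simp add: power_le_one)
  then have le1: "(\<integral>\<^sup>+j. ennreal (s ^ j) \<partial>measure_pmf q) \<le> 1" by (simp add: measure_pmf.emeasure_space_1)
  have nt: "(\<Sum>j. ennreal (pmf q j * s ^ j)) \<noteq> \<top>"
    using le1 by (auto simp: eq top_unique)
  have sm: "summable (\<lambda>j. pmf q j * s ^ j)"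
    using s by (intro summable_suminf_not_top nt) auto
  then show "(\<lambda>j. pmf q j * s ^ j) sums pgf q s" by (simp add: pgf_def summable_sums)
  show "0 \<le> pgf q s" unfolding pgf_def using s by (intro suminf_nonneg sm) auto
  show "(\<integral>\<^sup>+j. ennreal (s ^ j) \<partial>measure_pmf q) = ennreal (pgf q s)"
    unfolding eq pgf_def using s by (intro suminf_ennreal2 sm) auto
  then show "pgf q s \<le> 1" using le1 \<open>0 \<le> pgf q s\<close> by (simp add: ennreal_le_1)
qed

lemmas pgf_sums = pgf_basics(1) and pgf_nonneg = pgf_basics(2) and pgf_le_1 = pgf_basics(3)
  and nn_integral_pgf = pgf_basics(4)

text \<open>
For the linear fractional law with parameters \<open>a\<close> and \<open>p\<close> this is \<open>p / (1 - a)\<close>, that is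
\<open>f''(1) / (2 f'(1)\<^sup>2)\<close> for its generating function \<open>f\<close>. The form chosen here is measurable by inspection and
gives \<open>exp (- log_mean q) + curvature q = 1 / (1 - pmf q 0)\<close> for every \<open>q\<close>.
\<close>

definition curvature :: "nat pmf \<Rightarrow> real" where
  "curvature q = 1 / (1 - pmf q 0) - exp (- log_mean q)"

lemma measurable_curvature [measurable]: "curvature \<in> borel_measurable offspring_laws"
  unfolding curvature_def [abs_def] by measurable

text \<open>
In the coordinate \<open>1 / (1 - s)\<close> the generating function is the affine map with slope \<open>exp (- log_mean q)\<close>
and intercept \<open>curvature q\<close>. Stated for \<open>1 - s\<close> instead of its reciprocal, this includes \<open>s = 1\<close>.
\<close>

lemma linear_fractional_pgf:
  assumes "linear_fractional q"
  shows "0 < curvature q" and "pmf q 0 < 1"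
    and "0 \<le> s \<Longrightarrow> s \<le> 1 \<Longrightarrow>
      1 - pgf q s = (1 - s) / (exp (- log_mean q) + curvature q * (1 - s))"
proof -
  obtain a p where ap: "0 \<le> a" "a < 1" "0 < p" "p < 1" "pmf q 0 = a"
    and pk: "\<And>k. 1 \<le> k \<Longrightarrow> pmf q k = (1 - a) * (1 - p) / p * p ^ k"
    using assms unfolding linear_fractional_def by blast
  have "(\<lambda>n. real (Suc n) * p ^ n) sums (1 / (1 - p)^2)"
    using geometric_deriv_sums[of p] ap by simp
  then have "(\<lambda>n. (1 - a) * (1 - p) * (real (Suc n) * p ^ n)) sums ((1 - a) * (1 - p) * (1 / (1 - p)^2))"
    by (rule sums_mult)
  also have "(1 - a) * (1 - p) * (1 / (1 - p)^2) = (1 - a) / (1 - p)"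
    by (simp add: power2_eq_square)
  also have "(\<lambda>n. (1 - a) * (1 - p) * (real (Suc n) * p ^ n)) = (\<lambda>n. real (Suc n) * pmf q (Suc n))"
    using ap by (auto simp: pk)
  finally have "(\<lambda>n. real n * pmf q n) sums ((1 - a) / (1 - p))"
    by (subst (asm) sums_Suc_iff) simp
  then have mean: "offspring_mean q = (1 - a) / (1 - p)"
    by (simp add: offspring_mean_def sums_iff)
  then have em: "exp (- log_mean q) = (1 - p) / (1 - a)"
    using ap by (simp add: log_mean_def exp_minus)
  then have cv: "curvature q = p / (1 - a)"
    using ap by (simp add: curvature_def field_simps)
  show "0 < curvature q" "pmf q 0 < 1" using ap cv by auto
  assume s: "0 \<le> s" "s \<le> 1"
  have ps: "p * s < 1" using ap s by (meson le_less_trans mult_left_le less_imp_le)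
  then have "(\<lambda>n. (p * s) ^ n) sums (1 / (1 - p * s))"
    using ap s by (intro geometric_sums) (simp add: abs_mult)
  then have "(\<lambda>n. (1 - a) * (1 - p) * s * (p * s) ^ n) sums ((1 - a) * (1 - p) * s * (1 / (1 - p * s)))"
    by (rule sums_mult)
  also have "(\<lambda>n. (1 - a) * (1 - p) * s * (p * s) ^ n) = (\<lambda>n. pmf q (Suc n) * s ^ Suc n)"
    using ap by (auto simp: pk power_mult_distrib)
  finally have "(\<lambda>n. pmf q n * s ^ n) sums ((1 - a) * (1 - p) * s * (1 / (1 - p * s)) + a)"
    by (subst (asm) sums_Suc_iff) (use ap in simp)
  then have pgf: "pgf q s = (1 - a) * (1 - p) * s * (1 / (1 - p * s)) + a"
    using pgf_sums[OF s, of q] by (simp add: sums_unique2)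
  have "1 - pgf q s = (1 - a) * (1 - s) / (1 - p * s)"
    unfolding pgf using ps by (simp add: field_simps)
  also have "\<dots> = (1 - s) / ((1 - p) / (1 - a) + p / (1 - a) * (1 - s))"
  proof -
    have "(1 - p) / (1 - a) + p / (1 - a) * (1 - s) = (1 - p * s) / (1 - a)"
      using ap by (simp add: field_simps)
    then show ?thesis by (simp add: mult.commute)
  qed
  finally show "1 - pgf q s = (1 - s) / (exp (- log_mean q) + curvature q * (1 - s))"
    by (simp add: em cv)
qed

text \<open>
Linear fractional functions are geometric series; this one is the generating function of \<open>Z\<^sub>n\<close> in an
environment with discount \<open>a\<close> and perpetuity \<open>b\<close>.
\<close>

lemma linear_fractional_expansion:
  fixes a b s :: real
  assumes "0 < a" "0 \<le> b" "0 \<le> s" "s < 1"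
  shows "(\<lambda>j. (if j = 0 then 1 - 1 / (a + b) else a * b ^ (j - 1) / (a + b) ^ (j + 1)) * s ^ j)
    sums (1 - (1 - s) / (a + b * (1 - s)))"
proof -
  have bs: "b * s \<le> b" using assms by (simp add: mult_left_le)
  define r where "r = b * s / (a + b)"
  have r: "0 \<le> r" "r < 1" using assms bs by (auto simp: r_def divide_less_eq)
  have "(\<lambda>n. r ^ n) sums (1 / (1 - r))" using r by (intro geometric_sums) auto
  then have "(\<lambda>n. a * s / (a + b)^2 * r ^ n) sums (a * s / (a + b)^2 * (1 / (1 - r)))"
    by (rule sums_mult)
  also have "(\<lambda>n. a * s / (a + b)^2 * r ^ n)
    = (\<lambda>n. (if Suc n = 0 then 1 - 1 / (a + b) else a * b ^ (Suc n - 1) / (a + b) ^ (Suc n + 1)) * s ^ Suc n)"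
    by (auto simp: r_def power_divide power_mult_distrib power2_eq_square mult_ac)
  finally have *: "(\<lambda>j. (if j = 0 then 1 - 1 / (a + b) else a * b ^ (j - 1) / (a + b) ^ (j + 1)) * s ^ j)
    sums (a * s / (a + b)^2 * (1 / (1 - r)) + (1 - 1 / (a + b)))"
    by (subst (asm) sums_Suc_iff) simp
  have "1 - r = (a + b * (1 - s)) / (a + b)"
    using assms by (simp add: r_def field_simps)
  then have eq1: "a * s / (a + b)^2 * (1 / (1 - r)) = a * s / ((a + b) * (a + b * (1 - s)))"
    using assms by (simp add: power2_eq_square)
  have "a + b \<noteq> 0" "a + b * (1 - s) \<noteq> 0"
    using assms by (auto simp: add_nonneg_eq_0_iff)
  then have eq2: "a * s / ((a + b) * (a + b * (1 - s))) + (1 - 1 / (a + b)) = 1 - (1 - s) / (a + b * (1 - s))"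
    by (simp add: divide_simps) (simp add: algebra_simps)
  show ?thesis using * unfolding eq1 eq2 .
qed

text \<open>
Generating functions are known for arguments in \<open>(0, 1)\<close> only, so uniqueness is derived from one-sided
limits at \<open>0\<close>: the first nonzero coefficient of the difference would be such a limit.
\<close>

lemma power_series_coefficients_unique:
  fixes a b :: "nat \<Rightarrow> real"
  assumes a: "\<And>n. \<bar>a n\<bar> \<le> 1" and b: "\<And>n. \<bar>b n\<bar> \<le> 1"
    and eq: "\<And>s. 0 < s \<Longrightarrow> s < 1 \<Longrightarrow> (\<Sum>n. a n * s ^ n) = (\<Sum>n. b n * s ^ n)"
  shows "a n = b n"
proof -
  define d where "d n = a n - b n" for n
  have sm1: "summable (\<lambda>n. c n * s ^ n)" if "\<And>n. \<bar>c n\<bar> \<le> 1" "\<bar>s\<bar> < 1" for c :: "nat \<Rightarrow> real" and s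
    using that
    by (intro summable_comparison_test'[OF summable_geometric[of "\<bar>s\<bar>"], of 0])
       (auto simp: abs_mult power_abs intro!: mult_left_le_one_le)
  have sm: "summable (\<lambda>n. d (m + n) * s ^ n)" if "\<bar>s\<bar> < 1" for m s
    unfolding d_def left_diff_distrib using that a b by (intro summable_diff sm1) auto
  have zero: "(\<Sum>n. d n * s ^ n) = 0" if "0 < s" "s < 1" for s
    unfolding d_def left_diff_distrib using that a b eq[OF that]
    by (subst suminf_diff[symmetric]) (auto intro!: sm1)
  have "d n = 0"
  proof (induction n rule: less_induct)
    case (less m)
    define g where "g s = (\<Sum>n. d (m + n) * s ^ n)" for s
    have "g s = 0" if s: "0 < s" "s < 1" for s
    proof -
      have "0 = (\<Sum>n. d (n + m) * s ^ (n + m)) + (\<Sum>i<m. d i * s ^ i)"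
        using suminf_split_initial_segment[OF sm[of s 0, simplified], of m] zero[OF s] s by simp
      also have "(\<Sum>i<m. d i * s ^ i) = 0" using less by simp
      also have "(\<Sum>n. d (n + m) * s ^ (n + m)) = (\<Sum>n. s ^ m * (d (m + n) * s ^ n))"
        by (simp add: power_add mult_ac add.commute)
      also have "\<dots> = s ^ m * g s" unfolding g_def using s by (intro suminf_mult sm) auto
      finally show ?thesis using s by simp
    qed
    then have "eventually (\<lambda>s. g s = 0) (at_right 0)"
      by (auto simp: eventually_at_right_field intro!: exI[of _ 1])
    then have "(g \<longlongrightarrow> 0) (at_right 0)"
      by (rule tendsto_eventually)
    moreover have "(g \<longlongrightarrow> d (m + 0)) (at 0)"
      by (rule powser_limit_0[of 1]) (auto simp: g_def intro!: summable_sums sm)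
    then have "(g \<longlongrightarrow> d m) (at_right 0)"
      by (intro tendsto_mono[OF at_le, of "{0<..}" UNIV]) auto
    ultimately show ?case by (intro tendsto_unique[of "at_right 0" g]) auto
  qed
  then show ?thesis by (simp add: d_def)
qed

text \<open>
The parameters can be read off from the masses at \<open>0\<close> and \<open>1\<close>. This removes the existential quantifiers and
shows that being linear fractional is a measurable property, as is needed to pass from the law
of \<open>Q\<close> to that of the environment.
\<close>

lemma linear_fractional_iff:
  "linear_fractional q \<longleftrightarrow>
     (let a = pmf q 0; p = 1 - pmf q 1 / (1 - a) in
       a < 1 \<and> 0 < p \<and> p < 1 \<and> (\<forall>k\<in>{1..}. pmf q k = (1 - a) * (1 - p) / p * p ^ k))"
proof
  assume "linear_fractional q"
  then obtain a p where ap: "0 \<le> a" "a < 1" "0 < p" "p < 1" "pmf q 0 = a"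
    and pk: "\<And>k. 1 \<le> k \<Longrightarrow> pmf q k = (1 - a) * (1 - p) / p * p ^ k"
    unfolding linear_fractional_def by blast
  have "1 - pmf q 1 / (1 - a) = p" using ap pk[of 1] by simp
  with ap pk show "let a = pmf q 0; p = 1 - pmf q 1 / (1 - a) in
       a < 1 \<and> 0 < p \<and> p < 1 \<and> (\<forall>k\<in>{1..}. pmf q k = (1 - a) * (1 - p) / p * p ^ k)"
    by (simp add: Let_def)
next
  assume "let a = pmf q 0; p = 1 - pmf q 1 / (1 - a) in
       a < 1 \<and> 0 < p \<and> p < 1 \<and> (\<forall>k\<in>{1..}. pmf q k = (1 - a) * (1 - p) / p * p ^ k)"
  then show "linear_fractional q"
    unfolding Let_def linear_fractional_def
    by (metis atLeast_iff pmf_nonneg)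
qed

lemma measurable_linear_fractional [measurable]:
  "Measurable.pred offspring_laws linear_fractional"
  unfolding linear_fractional_iff[abs_def] Let_def by measurable

lemma nn_integral_convolution_power:
  assumes s: "0 \<le> s" "s \<le> 1"
  shows "(\<integral>\<^sup>+j. ennreal (s ^ j) \<partial>measure_pmf (convolution_power q z)) = ennreal (pgf q s ^ z)"
proof (induction z)
  case (Suc z)
  have "(\<integral>\<^sup>+j. ennreal (s ^ j) \<partial>measure_pmf (convolution_power q (Suc z)))
    = (\<integral>\<^sup>+i. \<integral>\<^sup>+j. ennreal (s ^ i) * ennreal (s ^ j) \<partial>measure_pmf (convolution_power q z) \<partial>measure_pmf q)"
    using s by (simp add: nn_integral_pair_pmf' power_add ennreal_mult)
  also have "\<dots> = ennreal (pgf q s) * ennreal (pgf q s ^ z)"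
    using s by (simp add: nn_integral_cmult nn_integral_multc Suc.IH nn_integral_pgf)
  finally show ?case
    using s pgf_nonneg[OF s, of q] by (simp add: ennreal_mult)
qed simp

lemma convolution_power_pgf:
  assumes "0 \<le> s" "s \<le> 1"
  shows "pgf (convolution_power q z) s = pgf q s ^ z"
  using nn_integral_convolution_power[OF assms, of q z] nn_integral_pgf[OF assms, of "convolution_power q z"]
    pgf_nonneg[OF assms] by (simp add: ennreal_inj)

text \<open>
This form of the convolution sum displays the point masses as a measurable function of \<open>q\<close>.
\<close>

lemma pmf_convolution_power_Suc:
  "pmf (convolution_power q (Suc z)) j
    = enn2real (\<Sum>i. ennreal (pmf q i) * ennreal (if i \<le> j then pmf (convolution_power q z) (j - i) else 0))"
proof -
  have 1: "(\<integral>\<^sup>+y. indicator {j} (i + y) \<partial>measure_pmf (convolution_power q z))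
    = ennreal (if i \<le> j then pmf (convolution_power q z) (j - i) else 0)" for i
  proof (cases "i \<le> j")
    case True
    then have "(\<lambda>y. indicator {j} (i + y) :: ennreal) = indicator {j - i}"
      by (intro ext) (auto split: split_indicator)
    with True show ?thesis by (simp add: emeasure_pmf_single)
  next
    case False
    then have "(\<lambda>y. indicator {j} (i + y) :: ennreal) = (\<lambda>_. 0)"
      by (intro ext) (auto split: split_indicator)
    with False show ?thesis by simp
  qed
  have "ennreal (pmf (convolution_power q (Suc z)) j) = (\<integral>\<^sup>+y. indicator {j} y \<partial>measure_pmf (convolution_power q (Suc z)))"
    by (simp add: emeasure_pmf_single del: convolution_power.simps)
  also have "\<dots> = (\<integral>\<^sup>+i. \<integral>\<^sup>+y. indicator {j} (i + y) \<partial>measure_pmf (convolution_power q z) \<partial>measure_pmf q)"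
    by (simp only: convolution_power.simps nn_integral_map_pmf nn_integral_pair_pmf' case_prod_conv)
  also have "\<dots> = (\<Sum>i. ennreal (pmf q i) * ennreal (if i \<le> j then pmf (convolution_power q z) (j - i) else 0))"
    unfolding 1 by (simp only: nn_integral_measure_pmf nn_integral_count_space_nat)
  finally show ?thesis by (metis enn2real_ennreal pmf_nonneg)
qed

lemma measurable_pmf_convolution_power [measurable]:
  "(\<lambda>q. pmf (convolution_power q z) j) \<in> borel_measurable offspring_laws"
proof (induction z arbitrary: j)
  case (Suc z)
  note [measurable] = Suc.IH
  show ?case unfolding pmf_convolution_power_Suc by measurable
qed simp

section \<open>The law of the population size\<close>

context branching_process_re begin

text \<open>
The environment shifted to start at index \<open>0\<close>, to fit sequences over all natural numbers.
\<close>

definition env :: "'w \<Rightarrow> nat \<Rightarrow> nat pmf" where "env \<omega> i = Env (Suc i) \<omega>"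

abbreviation disc :: "'w \<Rightarrow> nat \<Rightarrow> real" where "disc \<omega> \<equiv> discount log_mean (env \<omega>)"
abbreviation perp :: "'w \<Rightarrow> nat \<Rightarrow> real" where "perp \<omega> \<equiv> perpetuity log_mean curvature (env \<omega>)"

lemma measurable_Env: "1 \<le> n \<Longrightarrow> Env n \<in> M \<rightarrow>\<^sub>M offspring_laws"
  using env_indep by (auto simp: indep_vars_def)

lemma measurable_env [measurable]: "env \<in> M \<rightarrow>\<^sub>M (\<Pi>\<^sub>M i\<in>UNIV. offspring_laws)"
  unfolding env_def [abs_def] by (rule measurable_PiM_single') (auto intro: measurable_Env)

lemma measurable_restrict_Env:
  "(\<lambda>\<omega>. \<lambda>i\<in>{1..}. Env i \<omega>) \<in> M \<rightarrow>\<^sub>M PiM {1..} (\<lambda>_. offspring_laws)"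
  by (rule measurable_restrict) (auto intro: measurable_Env)

lemma measurable_env_algebra_Env:
  assumes "1 \<le> n"
  shows "Env n \<in> env_algebra M Env \<rightarrow>\<^sub>M offspring_laws"
proof -
  have "(\<lambda>\<omega>. (\<lambda>i\<in>{1..}. Env i \<omega>) n) \<in> env_algebra M Env \<rightarrow>\<^sub>M offspring_laws"
    unfolding env_algebra_def using assms
    by (intro measurable_compose[OF measurable_vimage_algebra1 measurable_component_singleton])
       (auto simp: space_PiM split: if_splits)
  then show ?thesis using assms by simp
qed

lemma measurable_id_history: "(\<lambda>\<omega>. \<omega>) \<in> M \<rightarrow>\<^sub>M history M Env Z n"
  unfolding history_def
proof (rule measurable_vimage_algebra2)
  show "(\<lambda>\<omega>. (\<lambda>i\<in>{1..}. Env i \<omega>, \<lambda>i\<in>{..n}. Z i \<omega>))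
    \<in> M \<rightarrow>\<^sub>M PiM {1..} (\<lambda>_. offspring_laws) \<Otimes>\<^sub>M PiM {..n} (\<lambda>_. count_space UNIV)"
    by (intro measurable_Pair measurable_restrict_Env measurable_restrict random_size)
qed auto

lemma measurable_history_env_algebra: "(\<lambda>\<omega>. \<omega>) \<in> history M Env Z n \<rightarrow>\<^sub>M env_algebra M Env"
  unfolding env_algebra_def
proof (rule measurable_vimage_algebra2)
  have "(\<lambda>\<omega>. fst (\<lambda>i\<in>{1..}. Env i \<omega>, \<lambda>i\<in>{..n}. Z i \<omega>))
    \<in> history M Env Z n \<rightarrow>\<^sub>M PiM {1..} (\<lambda>_. offspring_laws)"
    unfolding history_def
    by (rule measurable_compose[OF measurable_vimage_algebra1 measurable_fst])
       (auto simp: space_pair_measure space_PiM extensional_def)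
  then show "(\<lambda>\<omega>. \<lambda>i\<in>{1..}. Env i \<omega>) \<in> history M Env Z n \<rightarrow>\<^sub>M PiM {1..} (\<lambda>_. offspring_laws)"
    by simp
qed (simp add: history_def)

lemma subalgebra_history: "subalgebra M (history M Env Z n)"
  unfolding subalgebra_def
proof
  show sp: "space (history M Env Z n) = space M" by (simp add: history_def)
  show "sets (history M Env Z n) \<subseteq> sets M"
  proof
    fix E assume E: "E \<in> sets (history M Env Z n)"
    then have "(\<lambda>\<omega>. \<omega>) -` E \<inter> space M \<in> sets M"
      by (rule measurable_sets[OF measurable_id_history])
    with sets.sets_into_space[OF E] show "E \<in> sets M"
      by (simp add: sp Int_absorb2)
  qed
qed

lemma measurable_env_algebra_imp:
  "f \<in> env_algebra M Env \<rightarrow>\<^sub>M N \<Longrightarrow> f \<in> history M Env Z n \<rightarrow>\<^sub>M N"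
  "f \<in> env_algebra M Env \<rightarrow>\<^sub>M N \<Longrightarrow> f \<in> M \<rightarrow>\<^sub>M N"
  using measurable_compose[OF measurable_history_env_algebra]
    measurable_compose[OF measurable_compose[OF measurable_id_history[of n] measurable_history_env_algebra]]
  by auto

text \<open>
Conditioning on the environment and the past replaces the last generation by its generating
function. Letting \<open>\<phi>\<close> depend on the environment is what allows this step to be iterated: the new
argument \<open>pgf (Env (n + 1)) \<phi>\<close> is random even if \<open>\<phi>\<close> is constant.
\<close>

lemma nn_integral_power_step:
  assumes \<phi>: "\<phi> \<in> borel_measurable (env_algebra M Env)" and "\<And>\<omega>. 0 \<le> \<phi> \<omega>" "\<And>\<omega>. \<phi> \<omega> \<le> 1"
  shows "(\<integral>\<^sup>+\<omega>. ennreal (\<phi> \<omega> ^ Z (Suc n) \<omega>) \<partial>M)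
    = (\<integral>\<^sup>+\<omega>. ennreal (pgf (Env (Suc n) \<omega>) (\<phi> \<omega>) ^ Z n \<omega>) \<partial>M)"
proof -
  interpret H: finite_measure_subalgebra M "history M Env Z n"
    by unfold_locales (rule subalgebra_history)
  note [measurable] = measurable_env_algebra_imp(2)[OF \<phi>] random_size measurable_Env[of "Suc n", simplified]
  have [measurable]: "\<phi> \<in> borel_measurable (history M Env Z n)"
    by (rule measurable_env_algebra_imp[OF \<phi>])
  define c where "c \<omega> j = pmf (convolution_power (Env (Suc n) \<omega>) (Z n \<omega>)) j" for \<omega> j
  have [measurable]: "(\<lambda>\<omega>. c \<omega> j) \<in> borel_measurable M" for j
    unfolding c_def
    by (rule measurable_compose_countable[where f="\<lambda>z \<omega>. pmf (convolution_power (Env (Suc n) \<omega>) z) j" and g="Z n"])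
       measurable
  have c01: "0 \<le> c \<omega> j" "c \<omega> j \<le> 1" for \<omega> j
    by (simp_all add: c_def pmf_le_1)
  \<comment> \<open>The definition of the process, tested against the history-measurable weight \<open>\<phi>\<^bsup>j\<^esup>\<close>.\<close>
  have summand: "(\<integral>\<^sup>+\<omega>. ennreal (\<phi> \<omega> ^ j * indicator {\<omega>\<in>space M. Z (Suc n) \<omega> = j} \<omega>) \<partial>M)
    = (\<integral>\<^sup>+\<omega>. ennreal (\<phi> \<omega> ^ j * c \<omega> j) \<partial>M)" for j
  proof -
    let ?I = "indicator {\<omega>\<in>space M. Z (Suc n) \<omega> = j} :: 'w \<Rightarrow> real"
    have le1: "\<phi> \<omega> ^ j \<le> 1" "0 \<le> \<phi> \<omega> ^ j" for \<omega> using assms by (auto intro: power_le_one)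
    have int1: "integrable M (\<lambda>\<omega>. \<phi> \<omega> ^ j * ?I \<omega>)"
      using le1 by (intro integrable_const_bound[where B=1]) (auto simp: abs_mult intro!: mult_le_one split: split_indicator)
    have int2: "integrable M (\<lambda>\<omega>. \<phi> \<omega> ^ j * c \<omega> j)"
      using le1 by (intro integrable_const_bound[where B=1])
        (auto simp: abs_mult c01 intro!: mult_le_one)
    have "(\<integral>\<omega>. \<phi> \<omega> ^ j * ?I \<omega> \<partial>M) = (\<integral>\<omega>. \<phi> \<omega> ^ j * real_cond_exp M (history M Env Z n) ?I \<omega> \<partial>M)"
      by (rule H.real_cond_exp_intg(2)[symmetric, OF int1]) measurable
    also have "\<dots> = (\<integral>\<omega>. \<phi> \<omega> ^ j * c \<omega> j \<partial>M)"
    proof (rule integral_cong_AE)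
      show "AE \<omega> in M. \<phi> \<omega> ^ j * real_cond_exp M (history M Env Z n) ?I \<omega> = \<phi> \<omega> ^ j * c \<omega> j"
        using branching[of "Suc n" j] by (auto simp: c_def)
    qed measurable
    finally have "(\<integral>\<omega>. \<phi> \<omega> ^ j * ?I \<omega> \<partial>M) = \<dots>" .
    moreover have "(\<integral>\<^sup>+\<omega>. ennreal (\<phi> \<omega> ^ j * ?I \<omega>) \<partial>M) = ennreal (\<integral>\<omega>. \<phi> \<omega> ^ j * ?I \<omega> \<partial>M)"
      using le1 by (intro nn_integral_eq_integral int1) auto
    moreover have "(\<integral>\<^sup>+\<omega>. ennreal (\<phi> \<omega> ^ j * c \<omega> j) \<partial>M) = ennreal (\<integral>\<omega>. \<phi> \<omega> ^ j * c \<omega> j \<partial>M)"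
      using le1 by (intro nn_integral_eq_integral int2) (auto simp: c_def)
    ultimately show ?thesis by simp
  qed
  have "(\<integral>\<^sup>+\<omega>. ennreal (\<phi> \<omega> ^ Z (Suc n) \<omega>) \<partial>M)
    = (\<integral>\<^sup>+\<omega>. (\<Sum>j. ennreal (\<phi> \<omega> ^ j * indicator {\<omega>\<in>space M. Z (Suc n) \<omega> = j} \<omega>)) \<partial>M)"
  proof (rule nn_integral_cong)
    fix \<omega> assume "\<omega> \<in> space M"
    then have "(\<Sum>j. ennreal (\<phi> \<omega> ^ j * indicator {\<omega>\<in>space M. Z (Suc n) \<omega> = j} \<omega>))
      = (\<Sum>j\<in>{Z (Suc n) \<omega>}. ennreal (\<phi> \<omega> ^ j * indicator {\<omega>\<in>space M. Z (Suc n) \<omega> = j} \<omega>))"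
      by (intro suminf_finite) auto
    with \<open>\<omega> \<in> space M\<close> show "ennreal (\<phi> \<omega> ^ Z (Suc n) \<omega>)
      = (\<Sum>j. ennreal (\<phi> \<omega> ^ j * indicator {\<omega>\<in>space M. Z (Suc n) \<omega> = j} \<omega>))"
      by simp
  qed
  also have "\<dots> = (\<integral>\<^sup>+\<omega>. (\<Sum>j. ennreal (\<phi> \<omega> ^ j * c \<omega> j)) \<partial>M)"
    by (simp add: nn_integral_suminf summand)
  also have "\<dots> = (\<integral>\<^sup>+\<omega>. ennreal (pgf (Env (Suc n) \<omega>) (\<phi> \<omega>) ^ Z n \<omega>) \<partial>M)"
  proof (rule nn_integral_cong)
    fix \<omega>
    have "(\<lambda>j. c \<omega> j * \<phi> \<omega> ^ j) sums pgf (convolution_power (Env (Suc n) \<omega>) (Z n \<omega>)) (\<phi> \<omega>)"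
      unfolding c_def by (rule pgf_sums) (use assms in auto)
    then have "(\<lambda>j. \<phi> \<omega> ^ j * c \<omega> j) sums (pgf (Env (Suc n) \<omega>) (\<phi> \<omega>) ^ Z n \<omega>)"
      using assms by (simp add: convolution_power_pgf mult.commute)
    then show "(\<Sum>j. ennreal (\<phi> \<omega> ^ j * c \<omega> j)) = ennreal (pgf (Env (Suc n) \<omega>) (\<phi> \<omega>) ^ Z n \<omega>)"
      using assms by (intro suminf_ennreal_eq) (auto simp: c_def)
  qed
  finally show ?thesis .
qed

text \<open>
Each application of the previous lemma composes with one more affine map in the coordinate \<open>1 / (1 - s)\<close>,
starting from the last generation.
\<close>

lemma nn_integral_power_size:
  assumes start: "AE \<omega> in M. Z 0 \<omega> = 1" and lf: "AE \<omega> in M. \<forall>i. linear_fractional (env \<omega> i)"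
    and "\<phi> \<in> borel_measurable (env_algebra M Env)" "\<And>\<omega>. 0 \<le> \<phi> \<omega>" "\<And>\<omega>. \<phi> \<omega> \<le> 1"
  shows "(\<integral>\<^sup>+\<omega>. ennreal (\<phi> \<omega> ^ Z n \<omega>) \<partial>M)
    = (\<integral>\<^sup>+\<omega>. ennreal (1 - (1 - \<phi> \<omega>) / (disc \<omega> n + perp \<omega> n * (1 - \<phi> \<omega>))) \<partial>M)"
  using assms(3-)
proof (induction n arbitrary: \<phi>)
  case (0 \<phi>)
  show ?case
    by (rule nn_integral_cong_AE, use start in eventually_elim) simp
next
  case (Suc n \<phi>)
  note [measurable] = Suc.prems(1) measurable_env_algebra_Env[of "Suc n", simplified]
  let ?\<psi> = "\<lambda>\<omega>. pgf (Env (Suc n) \<omega>) (\<phi> \<omega>)"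
  have "(\<integral>\<^sup>+\<omega>. ennreal (\<phi> \<omega> ^ Z (Suc n) \<omega>) \<partial>M) = (\<integral>\<^sup>+\<omega>. ennreal (?\<psi> \<omega> ^ Z n \<omega>) \<partial>M)"
    by (rule nn_integral_power_step[OF Suc.prems])
  also have "\<dots> = (\<integral>\<^sup>+\<omega>. ennreal (1 - (1 - ?\<psi> \<omega>) / (disc \<omega> n + perp \<omega> n * (1 - ?\<psi> \<omega>))) \<partial>M)"
  proof (rule Suc.IH)
    show "?\<psi> \<in> borel_measurable (env_algebra M Env)" unfolding pgf_def by measurable
  qed (use Suc.prems in \<open>auto intro: pgf_nonneg pgf_le_1\<close>)
  also have "\<dots> = (\<integral>\<^sup>+\<omega>. ennreal (1 - (1 - \<phi> \<omega>) / (disc \<omega> (Suc n) + perp \<omega> (Suc n) * (1 - \<phi> \<omega>))) \<partial>M)"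
  proof (rule nn_integral_cong_AE, use lf in eventually_elim)
    case (elim \<omega>)
    let ?q = "Env (Suc n) \<omega>"
    have q: "linear_fractional ?q" using elim[rule_format, of n] by (simp add: env_def)
    define u where "u = 1 - \<phi> \<omega>"
    define d where "d = exp (- log_mean ?q) + curvature ?q * u"
    have "0 \<le> u" using Suc.prems by (simp add: u_def)
    then have "0 < d" using linear_fractional_pgf(1)[OF q] by (auto simp: d_def intro!: add_pos_nonneg)
    have "1 - ?\<psi> \<omega> = u / d"
      unfolding u_def d_def using Suc.prems by (intro linear_fractional_pgf(3)[OF q]) auto
    moreover have "u / d / (disc \<omega> n + perp \<omega> n * (u / d)) = u / (disc \<omega> n * d + perp \<omega> n * u)"
    proof -
      have "disc \<omega> n + perp \<omega> n * (u / d) = (disc \<omega> n * d + perp \<omega> n * u) / d"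
        using \<open>0 < d\<close> by (simp add: field_simps)
      then show ?thesis using \<open>0 < d\<close> by simp
    qed
    moreover have "disc \<omega> n * d + perp \<omega> n * u = disc \<omega> (Suc n) + perp \<omega> (Suc n) * u"
      by (simp add: d_def discount_Suc perpetuity_Suc env_def algebra_simps)
    ultimately have "(1 - ?\<psi> \<omega>) / (disc \<omega> n + perp \<omega> n * (1 - ?\<psi> \<omega>))
      = u / (disc \<omega> (Suc n) + perp \<omega> (Suc n) * u)" by simp
    then show ?case by (simp only: u_def)
  qed
  finally show ?case .
qed

text \<open>
Both sides are coefficients of the same power series, by the previous lemma for constant \<open>\<phi>\<close>.
\<close>

lemma prob_size_eq:
  assumes start: "AE \<omega> in M. Z 0 \<omega> = 1" and lf: "AE \<omega> in M. \<forall>i. linear_fractional (env \<omega> i)"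
    and "1 \<le> k"
  shows "ennreal (prob {\<omega>\<in>space M. Z n \<omega> = k})
    = (\<integral>\<^sup>+\<omega>. ennreal (disc \<omega> n * perp \<omega> n ^ (k - 1) / (disc \<omega> n + perp \<omega> n) ^ (k + 1)) \<partial>M)"
proof -
  note [measurable] = random_size
  define c where "c \<omega> j = (if j = 0 then 1 - 1 / (disc \<omega> n + perp \<omega> n)
    else disc \<omega> n * perp \<omega> n ^ (j - 1) / (disc \<omega> n + perp \<omega> n) ^ (j + 1))" for \<omega> and j :: nat
  have [measurable]: "(\<lambda>\<omega>. c \<omega> j) \<in> borel_measurable M" for j
    unfolding c_def by measurable
  have AB: "AE \<omega> in M. 0 \<le> perp \<omega> n \<and> 1 \<le> disc \<omega> n + perp \<omega> n"
    using lf
  proof eventually_elim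
    case (elim \<omega>)
    have q: "0 < curvature (env \<omega> i)" "pmf (env \<omega> i) 0 < 1" for i
      using elim linear_fractional_pgf(1,2) by auto
    have 1: "1 \<le> exp (- log_mean (env \<omega> i)) + curvature (env \<omega> i)" for i
      using q(2)[of i] by (simp add: curvature_def)
    have "\<forall>i. 0 < curvature (env \<omega> i) \<and> 1 \<le> exp (- log_mean (env \<omega> i)) + curvature (env \<omega> i)"
      using q 1 by blast
    then show ?case using perpetuity_bounds(1,4)[of curvature "env \<omega>" log_mean n] by blast
  qed
  have c01: "AE \<omega> in M. \<forall>j. 0 \<le> c \<omega> j \<and> c \<omega> j \<le> 1"
    using AB
  proof eventually_elim
    case (elim \<omega>)
    let ?a = "disc \<omega> n" and ?b = "perp \<omega> n"
    have "?a * ?b ^ (j - 1) / (?a + ?b) ^ (j + 1) \<le> 1" if "j \<noteq> 0" for j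
    proof -
      obtain i where j: "j = Suc i" using \<open>j \<noteq> 0\<close> by (cases j) auto
      have "?a * ?b ^ i \<le> (?a + ?b) * (?a + ?b) ^ i"
        using elim by (intro mult_mono power_mono) auto
      also have "\<dots> = (?a + ?b) ^ j * 1" by (simp add: j)
      also have "\<dots> \<le> (?a + ?b) ^ j * (?a + ?b)" using elim by (intro mult_left_mono) auto
      finally show ?thesis using elim by (auto simp: j divide_le_eq_1 mult_ac)
    qed
    then show ?case using elim by (auto simp: c_def intro!: divide_nonneg_nonneg mult_nonneg_nonneg)
  qed
  have int_c: "integrable M (\<lambda>\<omega>. c \<omega> j)" for j
  proof (rule integrable_const_bound[where B=1])
    show "AE \<omega> in M. norm (c \<omega> j) \<le> 1" using c01 by eventually_elim auto
  qed measurable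
  define m where "m j = (\<integral>\<omega>. c \<omega> j \<partial>M)" for j
  have nn_m: "(\<integral>\<^sup>+\<omega>. ennreal (c \<omega> j) \<partial>M) = ennreal (m j)" for j
    unfolding m_def by (rule nn_integral_eq_integral[OF int_c]) (use c01 in eventually_elim, auto)
  have m0: "0 \<le> m j" for j
    unfolding m_def by (rule integral_nonneg_AE) (use c01 in eventually_elim, auto)
  have m1: "m j \<le> 1" for j
  proof -
    have "m j \<le> (\<integral>\<omega>. 1 \<partial>M)"
      unfolding m_def by (rule integral_mono_AE[OF int_c]) (simp, use c01 in eventually_elim, auto)
    then show ?thesis by (simp add: prob_space)
  qed
  define P where "P j = prob {\<omega>\<in>space M. Z n \<omega> = j}" for j
  have sm: "summable (\<lambda>j. d j * s ^ j)" if "\<And>j. 0 \<le> d j \<and> d j \<le> 1" "0 < s" "s < 1" for d :: "nat \<Rightarrow> real" and s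
    using that by (intro summable_comparison_test'[OF summable_geometric[of s], of 0])
      (auto simp: abs_mult intro!: mult_left_le_one_le)
  have "P k = m k"
  proof (rule power_series_coefficients_unique)
    show "\<bar>P j\<bar> \<le> 1" "\<bar>m j\<bar> \<le> 1" for j using m0 m1 by (auto simp: P_def)
    fix s :: real assume s: "0 < s" "s < 1"
    have "(\<Sum>j. ennreal (P j * s ^ j)) = (\<Sum>j. \<integral>\<^sup>+\<omega>. ennreal (s ^ j) * indicator {\<omega>\<in>space M. Z n \<omega> = j} \<omega> \<partial>M)"
      using s by (auto simp: P_def nn_integral_cmult_indicator emeasure_eq_measure ennreal_mult mult.commute)
    also have "\<dots> = (\<integral>\<^sup>+\<omega>. (\<Sum>j. ennreal (s ^ j) * indicator {\<omega>\<in>space M. Z n \<omega> = j} \<omega>) \<partial>M)"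
      by (rule nn_integral_suminf[symmetric]) measurable
    also have "\<dots> = (\<integral>\<^sup>+\<omega>. ennreal (s ^ Z n \<omega>) \<partial>M)"
    proof (rule nn_integral_cong)
      fix \<omega> assume "\<omega> \<in> space M"
      then have "(\<Sum>j. ennreal (s ^ j) * indicator {\<omega>\<in>space M. Z n \<omega> = j} \<omega>)
        = (\<Sum>j\<in>{Z n \<omega>}. ennreal (s ^ j) * indicator {\<omega>\<in>space M. Z n \<omega> = j} \<omega>)"
        by (intro suminf_finite) auto
      with \<open>\<omega> \<in> space M\<close> show "(\<Sum>j. ennreal (s ^ j) * indicator {\<omega>\<in>space M. Z n \<omega> = j} \<omega>) = ennreal (s ^ Z n \<omega>)"
        by simp
    qed
    also have "\<dots> = (\<integral>\<^sup>+\<omega>. ennreal (1 - (1 - s) / (disc \<omega> n + perp \<omega> n * (1 - s))) \<partial>M)"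
      using s by (intro nn_integral_power_size[OF start lf]) auto
    also have "\<dots> = (\<integral>\<^sup>+\<omega>. (\<Sum>j. ennreal (s ^ j) * ennreal (c \<omega> j)) \<partial>M)"
    proof (rule nn_integral_cong_AE, use AB c01 in eventually_elim)
      case (elim \<omega>)
      have "(\<lambda>j. c \<omega> j * s ^ j) sums (1 - (1 - s) / (disc \<omega> n + perp \<omega> n * (1 - s)))"
        unfolding c_def using elim s by (intro linear_fractional_expansion) auto
      then have "(\<Sum>j. ennreal (c \<omega> j * s ^ j)) = ennreal (1 - (1 - s) / (disc \<omega> n + perp \<omega> n * (1 - s)))"
        using elim s by (intro suminf_ennreal_eq) auto
      then show ?case using elim s by (simp add: ennreal_mult mult.commute)
    qed
    also have "\<dots> = (\<Sum>j. ennreal (m j * s ^ j))"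
      using s m0 by (subst nn_integral_suminf) (auto simp: nn_integral_cmult nn_m ennreal_mult mult.commute)
    finally have eq: "(\<Sum>j. ennreal (P j * s ^ j)) = (\<Sum>j. ennreal (m j * s ^ j))" .
    have "ennreal (\<Sum>j. P j * s ^ j) = (\<Sum>j. ennreal (P j * s ^ j))"
      using s by (intro suminf_ennreal2[symmetric] sm) (auto simp: P_def)
    moreover have "ennreal (\<Sum>j. m j * s ^ j) = (\<Sum>j. ennreal (m j * s ^ j))"
      using s m0 m1 by (intro suminf_ennreal2[symmetric] sm) auto
    moreover have "0 \<le> (\<Sum>j. P j * s ^ j)" "0 \<le> (\<Sum>j. m j * s ^ j)"
      using s m0 m1 by (auto intro!: suminf_nonneg sm simp: P_def)
    ultimately show "(\<Sum>j. P j * s ^ j) = (\<Sum>j. m j * s ^ j)"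
      using eq by (metis ennreal_inj)
  qed
  then have "ennreal (prob {\<omega>\<in>space M. Z n \<omega> = k}) = (\<integral>\<^sup>+\<omega>. ennreal (c \<omega> k) \<partial>M)"
    by (simp add: nn_m P_def)
  then show ?thesis using \<open>1 \<le> k\<close> by (simp add: c_def)
qed

lemma distr_env: "distr M (\<Pi>\<^sub>M i\<in>UNIV. offspring_laws) env = (\<Pi>\<^sub>M i\<in>UNIV. distr M offspring_laws Q)"
proof -
  let ?D = "distr M offspring_laws Q" and ?O = "\<lambda>_. offspring_laws"
  let ?R = "\<lambda>\<omega>. \<lambda>i\<in>{1..}. Env i \<omega>" and ?shift = "\<lambda>\<omega>. \<lambda>i\<in>UNIV. \<omega> (Suc i)"
  have D: "prob_space ?D" by (rule prob_space_distr[OF random_law])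
  have "distr M (PiM {1..} ?O) ?R = PiM {1..} (\<lambda>i. distr M offspring_laws (Env i))"
    using env_indep by (subst (asm) indep_vars_iff_distr_eq_PiM') (auto intro: measurable_Env)
  also have "\<dots> = PiM {1..} (\<lambda>i. ?D)"
    by (rule PiM_cong) (auto simp: env_copies)
  finally have R: "distr M (PiM {1..} ?O) ?R = PiM {1..} (\<lambda>i. ?D)" .
  have shift: "?shift \<in> PiM {1..} ?O \<rightarrow>\<^sub>M PiM UNIV ?O"
    by (intro measurable_restrict measurable_component_singleton) auto
  have "(\<Pi>\<^sub>M i\<in>UNIV. ?D) = distr (PiM {1..} (\<lambda>i. ?D)) (PiM UNIV (\<lambda>i. ?D)) ?shift"
    using distr_PiM_reindex[of "{1..}" "\<lambda>_. ?D" Suc UNIV] D by auto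
  also have "\<dots> = distr (PiM {1..} (\<lambda>i. ?D)) (PiM UNIV ?O) ?shift"
    by (intro distr_cong sets_PiM_cong) auto
  also have "\<dots> = distr M (PiM UNIV ?O) (?shift \<circ> ?R)"
    unfolding R[symmetric] by (rule distr_distr[OF shift measurable_restrict_Env])
  also have "?shift \<circ> ?R = env" by (auto simp: env_def fun_eq_iff)
  finally show ?thesis by simp
qed

section \<open>The tilted environment\<close>

lemma AE_law_of_environment:
  assumes "AE \<omega> in M. P (Q \<omega>)" and [measurable]: "Measurable.pred offspring_laws P"
  shows "AE q in distr M offspring_laws Q. P q"
proof -
  have "{q \<in> space offspring_laws. P q} \<in> sets offspring_laws" by measurable
  from AE_distr_iff[OF random_law this] assms(1) show ?thesis by blast
qed

lemma AE_env_linear_fractional: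
  assumes "AE \<omega> in M. linear_fractional (Q \<omega>)"
  shows "AE \<omega> in M. \<forall>i. linear_fractional (env \<omega> i)"
proof -
  have "AE \<omega> in M. linear_fractional (env \<omega> i)" for i
  proof -
    have "AE q in distr M offspring_laws Q. linear_fractional q"
      by (rule AE_law_of_environment[OF assms]) measurable
    then have "AE q in distr M offspring_laws (Env (Suc i)). linear_fractional q"
      by (subst env_copies) auto
    then show ?thesis
      unfolding env_def by (rule AE_distrD[OF measurable_Env[of "Suc i"], rotated]) simp
  qed
  then show ?thesis by (simp add: AE_all_countable)
qed

text \<open>
Where \<open>X < - 1\<close>, the variable is dominated by \<open>\<bar>X\<bar> exp (- X)\<close>; elsewhere it is at most \<open>exp 1\<close>.
\<close>

lemma integrable_exp_minus_log_mean:
  assumes "integrable M (\<lambda>\<omega>. log_mean (Q \<omega>) * exp (- log_mean (Q \<omega>)))"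
  shows "integrable M (\<lambda>\<omega>. exp (- log_mean (Q \<omega>)))"
proof (rule Bochner_Integration.integrable_bound)
  note [measurable] = random_law
  show "integrable M (\<lambda>\<omega>. exp 1 + \<bar>log_mean (Q \<omega>) * exp (- log_mean (Q \<omega>))\<bar>)"
    using assms by auto
  have "exp (- x) \<le> exp 1 + \<bar>x * exp (- x)\<bar>" for x :: real
  proof (cases "- 1 \<le> x")
    case True
    then have "exp (- x) \<le> exp 1" by simp
    then show ?thesis by linarith
  next
    case False
    then have "1 * exp (- x) \<le> \<bar>x\<bar> * exp (- x)" by (intro mult_right_mono) auto
    moreover have "\<bar>x * exp (- x)\<bar> = \<bar>x\<bar> * exp (- x)" by (simp add: abs_mult)
    moreover have "0 < exp (1::real)" by simp
    ultimately show ?thesis by linarith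
  qed
  then show "AE \<omega> in M. norm (exp (- log_mean (Q \<omega>)))
    \<le> norm (exp 1 + \<bar>log_mean (Q \<omega>) * exp (- log_mean (Q \<omega>))\<bar>)"
    by auto
  show "(\<lambda>\<omega>. exp (- log_mean (Q \<omega>))) \<in> borel_measurable M" by measurable
qed

lemma tilt_const_pos:
  assumes "integrable M (\<lambda>\<omega>. exp (- log_mean (Q \<omega>)))"
  shows "0 < tilt_const M Q"
proof -
  have "tilt_const M Q \<noteq> 0"
    unfolding tilt_const_def by (subst integral_nonneg_eq_0_iff_AE[OF assms]) (auto simp: AE_False)
  moreover have "0 \<le> tilt_const M Q" unfolding tilt_const_def by simp
  ultimately show ?thesis by simp
qed

lemma prob_space_tilted_law:
  assumes int: "integrable M (\<lambda>\<omega>. exp (- log_mean (Q \<omega>)))"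
  shows "prob_space (tilted_law M Q)"
proof
  note [measurable] = random_law
  have "emeasure (tilted_law M Q) (space (tilted_law M Q))
    = (\<integral>\<^sup>+\<omega>. ennreal (exp (- log_mean (Q \<omega>)) / tilt_const M Q) \<partial>M)"
    using sets.top[of offspring_laws]
    by (simp add: tilted_law_def emeasure_density nn_integral_distr)
  also have "\<dots> = ennreal (\<integral>\<omega>. exp (- log_mean (Q \<omega>)) / tilt_const M Q \<partial>M)"
    using tilt_const_pos[OF int] by (intro nn_integral_eq_integral) (auto intro: int)
  also have "\<dots> = 1"
    using tilt_const_pos[OF int] by (simp add: tilt_const_def[symmetric])
  finally show "emeasure (tilted_law M Q) (space (tilted_law M Q)) = 1" .
qed

lemma AE_tilted_law:
  assumes "AE \<omega> in M. P (Q \<omega>)" and [measurable]: "Measurable.pred offspring_laws P"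
  shows "AE q in tilted_law M Q. P q"
proof -
  note [measurable] = random_law
  have "AE q in distr M offspring_laws Q. P q"
    using assms by (rule AE_law_of_environment)
  then show ?thesis unfolding tilted_law_def
    by (subst AE_density) (measurable, auto)
qed

lemma drifting_perpetuity_tilted_law:
  assumes lf: "AE \<omega> in M. linear_fractional (Q \<omega>)"
    and int: "integrable M (\<lambda>\<omega>. log_mean (Q \<omega>) * exp (- log_mean (Q \<omega>)))"
    and pos: "0 < (\<integral>\<omega>. log_mean (Q \<omega>) * exp (- log_mean (Q \<omega>)) \<partial>M)"
    and surv: "integrable (tilted_law M Q) (\<lambda>q. ln (1 - pmf q 0))"
  shows "drifting_perpetuity (tilted_law M Q) log_mean curvature"
proof -
  note [measurable] = random_law
  note int_exp = integrable_exp_minus_log_mean[OF int]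
  note \<gamma> = tilt_const_pos[OF int_exp]
  interpret T: sequence_space "tilted_law M Q"
    by (rule sequence_space_of_prob_space[OF prob_space_tilted_law[OF int_exp]])
  have [measurable_cong]: "sets (tilted_law M Q) = sets offspring_laws" by (simp add: tilted_law_def)
  have lfT: "AE q in tilted_law M Q. linear_fractional q"
    by (rule AE_tilted_law[OF lf]) measurable
  show ?thesis
  proof
    show "log_mean \<in> borel_measurable (tilted_law M Q)" "curvature \<in> borel_measurable (tilted_law M Q)"
      by measurable
    show "AE q in tilted_law M Q. 0 < curvature q"
      using lfT by eventually_elim (rule linear_fractional_pgf(1))
    show "AE q in tilted_law M Q. 1 \<le> exp (- log_mean q) + curvature q"
      using lfT by eventually_elim (use linear_fractional_pgf(2) in \<open>simp add: curvature_def\<close>)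
    have "integrable M (\<lambda>\<omega>. log_mean (Q \<omega>) * exp (- log_mean (Q \<omega>)) / tilt_const M Q)"
      using int by simp
    then show "integrable (tilted_law M Q) log_mean"
      unfolding tilted_law_def using \<gamma>
      by (subst integrable_density) (auto simp: integrable_distr_eq mult.commute)
    show "0 < (\<integral>q. log_mean q \<partial>tilted_law M Q)"
      using \<gamma> pos by (subst integral_tilted_law) (auto simp: mult.commute)
    have "ln (exp (- log_mean q) + curvature q) = - ln (1 - pmf q 0)" for q
      by (simp add: curvature_def ln_div ln_inverse flip: inverse_eq_divide)
    then show "integrable (tilted_law M Q) (\<lambda>q. ln (exp (- log_mean q) + curvature q))"
      using surv by simp
  qed
qed

lemma prob_size_eq_tilted:
  assumes start: "AE \<omega> in M. Z 0 \<omega> = 1" and lf: "AE \<omega> in M. linear_fractional (Q \<omega>)"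
    and tilted: "drifting_perpetuity (tilted_law M Q) log_mean curvature"
    and \<gamma>: "0 < tilt_const M Q" and "1 \<le> k"
  shows "prob {\<omega>\<in>space M. Z n \<omega> = k}
    = tilt_const M Q ^ n * drifting_perpetuity.tilted_weight (tilted_law M Q) log_mean curvature k n"
proof -
  interpret T: drifting_perpetuity "tilted_law M Q" log_mean curvature by (rule tilted)
  let ?D = "distr M offspring_laws Q"
  let ?G = "\<lambda>(a, b). ennreal (b ^ (k - 1) / (a + b) ^ (k + 1))"
  have D: "prob_space ?D" by (rule prob_space_distr[OF random_law])
  have "ennreal (prob {\<omega>\<in>space M. Z n \<omega> = k})
    = (\<integral>\<^sup>+\<omega>. ennreal (disc \<omega> n) * ?G (disc \<omega> n, perp \<omega> n) \<partial>M)"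
    unfolding prob_size_eq[OF start AE_env_linear_fractional[OF lf] \<open>1 \<le> k\<close>]
    by (auto simp: ennreal_mult'[symmetric] intro!: nn_integral_cong)
  also have "\<dots> = (\<integral>\<^sup>+\<omega>. ennreal (T.A \<omega> n) * ?G (T.A \<omega> n, T.B \<omega> n)
      \<partial>distr M (\<Pi>\<^sub>M i\<in>UNIV. offspring_laws) env)"
    by (subst nn_integral_distr) auto
  also have "\<dots> = ennreal (tilt_const M Q ^ n) * (\<integral>\<^sup>+\<omega>. ?G (T.A \<omega> n, T.B \<omega> n) \<partial>T.S)"
    unfolding distr_env
    by (rule nn_integral_tilted_environment[OF D T.M.prob_space_axioms _ _ \<gamma>])
       (auto simp: tilted_law_def)
  also have "(\<integral>\<^sup>+\<omega>. ?G (T.A \<omega> n, T.B \<omega> n) \<partial>T.S) = ennreal (T.tilted_weight k n)"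
    using T.nn_integral_tilted_weight[OF \<open>1 \<le> k\<close>] by simp
  finally have "ennreal (prob {\<omega>\<in>space M. Z n \<omega> = k}) = ennreal (tilt_const M Q ^ n * T.tilted_weight k n)"
    using \<gamma> by (simp add: ennreal_mult')
  moreover have "0 \<le> T.tilted_weight k n"
    unfolding T.tilted_weight_def
  proof (rule integral_nonneg_AE)
    show "AE \<omega> in T.S. 0 \<le> T.B \<omega> n ^ (k - 1) / (T.A \<omega> n + T.B \<omega> n) ^ (k + 1)"
      using T.AE_positivity[of n] by eventually_elim simp
  qed
  ultimately show ?thesis using \<gamma> by (simp add: ennreal_inj)
qed

end

theorem theorem2p1p2:
  fixes M :: "'w measure" and Q :: "'w \<Rightarrow> nat pmf"
    and Env :: "nat \<Rightarrow> 'w \<Rightarrow> nat pmf" and Z :: "nat \<Rightarrow> 'w \<Rightarrow> nat" and c k :: nat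
  assumes process: "branching_process_re M Q Env Z"
    and start: "AE \<omega> in M. Z 0 \<omega> = 1"
    and lin_frac: "AE \<omega> in M. linear_fractional (Q \<omega>)"
    and supercritical: "pos_expectation M (\<lambda>\<omega>. log_mean (Q \<omega>))"
    and int_tilt: "integrable M (\<lambda>\<omega>. log_mean (Q \<omega>) * exp (- log_mean (Q \<omega>)))"
    and pos_tilt: "0 < (\<integral>\<omega>. log_mean (Q \<omega>) * exp (- log_mean (Q \<omega>)) \<partial>M)"
    and log_surv: "integrable (tilted_law M Q) (\<lambda>q. ln (1 - pmf q 0))"
    and k: "1 \<le> k" "k \<le> c"
  shows "(\<lambda>n. \<P>(\<omega> in M. Z n \<omega> = k \<bar> 1 \<le> Z n \<omega> \<and> Z n \<omega> \<le> c)) \<longlonglongrightarrow> 1 / real c"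
proof -
  interpret branching_process_re M Q Env Z by (rule process)
  note [measurable] = random_size
  interpret T: drifting_perpetuity "tilted_law M Q" log_mean curvature
    by (rule drifting_perpetuity_tilted_law[OF lin_frac int_tilt pos_tilt log_surv])
  have \<gamma>: "0 < tilt_const M Q"
    by (rule tilt_const_pos[OF integrable_exp_minus_log_mean[OF int_tilt]])
  obtain L where "0 < L" and L: "\<And>j. 1 \<le> j \<Longrightarrow> T.tilted_weight j \<longlonglongrightarrow> L"
    using T.tilted_weight_limit by blast
  have P: "prob {\<omega>\<in>space M. Z n \<omega> = j} = tilt_const M Q ^ n * T.tilted_weight j n" if "1 \<le> j" for j n
    by (rule prob_size_eq_tilted[OF start lin_frac T.drifting_perpetuity_axioms \<gamma> that])
  \<comment> \<open>The factor \<open>tilt_const M Q ^ n\<close> cancels.\<close>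
  have "\<P>(\<omega> in M. Z n \<omega> = k \<bar> 1 \<le> Z n \<omega> \<and> Z n \<omega> \<le> c) = T.tilted_weight k n / (\<Sum>j=1..c. T.tilted_weight j n)" for n
  proof -
    have "{\<omega>\<in>space M. Z n \<omega> = k \<and> 1 \<le> Z n \<omega> \<and> Z n \<omega> \<le> c} = {\<omega>\<in>space M. Z n \<omega> = k}"
      using k by auto
    moreover have "{\<omega>\<in>space M. 1 \<le> Z n \<omega> \<and> Z n \<omega> \<le> c} = (\<Union>j\<in>{1..c}. {\<omega>\<in>space M. Z n \<omega> = j})"
      by auto
    then have "prob {\<omega>\<in>space M. 1 \<le> Z n \<omega> \<and> Z n \<omega> \<le> c} = (\<Sum>j=1..c. prob {\<omega>\<in>space M. Z n \<omega> = j})"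
      by (simp only:) (rule finite_measure_finite_Union, auto simp: disjoint_family_on_def)
    moreover have "\<dots> = tilt_const M Q ^ n * (\<Sum>j=1..c. T.tilted_weight j n)"
      by (simp add: P sum_distrib_left)
    ultimately show ?thesis
      using \<gamma> k by (simp add: cond_prob_def P)
  qed
  moreover have "(\<lambda>n. T.tilted_weight k n / (\<Sum>j=1..c. T.tilted_weight j n)) \<longlonglongrightarrow> L / (\<Sum>j=1..c. L)"
    using k \<open>0 < L\<close> by (intro tendsto_divide tendsto_sum L) auto
  ultimately show ?thesis using \<open>0 < L\<close> k by simp
qed

end
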